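(* Let $0<p,\alpha<\infty$, $w\in A^{\mathrm{restricted}}_{\infty}$, and let $G\subset\mathbb{C}$ be a measurable set. Then $G$ is a dominating set for $F^p_{\alpha,\widehat{w}}$ if and only if there exist $R>0$ and $\delta\in(0,1)$ such that for any $a\in\mathbb{C}$, $$\widehat{w}\big(G\cap D(a,R)\big)>\delta\, \widehat{w}\big(D(a,R)\big).$$
   Context: $dA$ is Lebesgue measure on $\mathbb{C}$, and $D(a,R)$ is the Euclidean disk with center $a$ and radius $R$. A weight is a non-negative locally integrable function $w$ on $\mathbb{C}$, and $w(E):=\int_E w\,dA$ for measurable $E$. Squares $Q\subset\mathbb{C}$ have sides parallel to the coordinate axes and side length $\ell(Q)$. For $1<p<\infty$ with conjugate exponent $p'$ ($1/p+1/p'=1$), $A_p^{\mathrm{restricted}}$ is the class of weights $w$ such that for some (equivalently any) fixed $r>0$, $$\sup_{Q:\ell(Q)=r}\Big(\frac{1}{A(Q)}\int_{Q}w\,dA\Big)\Big(\frac{1}{A(Q)}\int_{Q}w^{-p'/p}dA\Big)^{p/p'}<\infty,$$ and $A_1^{\mathrm{restricted}}$ is the class of weights such that for some (equivalently any) fixed $r>0$, $\sup_{Q:\ell(Q)=r}\big(\frac{1}{A(Q)}\int_Q w\,dA\big)\|w^{-1}\|_{L^\infty(Q)}<\infty$ (convention $0\cdot\infty=\infty$, so $w>0$ a.e.). $A_\infty^{\mathrm{restricted}}:=\bigcup_{1\le p<\infty}A_p^{\mathrm{restricted}}$. $\widehat{w}(z):=w(D(z,1))/A(D(z,1))$ for $z\in\mathbb{C}$,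 and $\widehat w(E):=\int_E\widehat w\,dA$. For a weight $v$, $F^p_{\alpha,v}$ is the space of entire functions $f$ on $\mathbb{C}$ with $\|f\|^p_{F^p_{\alpha,v}}:=\int_{\mathbb{C}}|f(z)|^pe^{-\frac{p\alpha}{2}|z|^2}v(z)\,dA(z)<\infty$. A measurable set $G$ is a dominating set for $F^p_{\alpha,v}$ if there is $C>0$ such that $\|f\|^p_{F^p_{\alpha,v}}\le C\int_{G}|f(z)|^pe^{-\frac{p\alpha}{2}|z|^2}v(z)\,dA(z)$ for all $f\in F^p_{\alpha,v}$. *)

theory Defs
  imports "HOL-Analysis.Analysis" "HOL-Probability.Essential_Supremum"
begin

definition weight :: "(complex \<Rightarrow> real) \<Rightarrow> bool" where
  "weight w \<longleftrightarrow> (\<forall>z. 0 \<le> w z) \<and> (\<forall>K. compact K \<longrightarrow> set_integrable lebesgue K w)"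

definition wmass :: "(complex \<Rightarrow> real) \<Rightarrow> complex set \<Rightarrow> ennreal" where
  "wmass w E = (\<integral>\<^sup>+z\<in>E. ennreal (w z) \<partial>lebesgue)"

definition square :: "complex \<Rightarrow> real \<Rightarrow> complex set" where
  "square a r = cbox a (a + Complex r r)"

definition avg :: "complex set \<Rightarrow> (complex \<Rightarrow> ennreal) \<Rightarrow> ennreal" where
  "avg E g = (\<integral>\<^sup>+z\<in>E. g z \<partial>lebesgue) / emeasure lebesgue E"

text \<open>The product on \<open>[0,\<infinity>]\<close> with the convention \<open>0 \<cdot> \<infinity> = \<infinity>\<close>; the product of
  \<^typ>\<open>ennreal\<close> has \<open>0 \<cdot> \<infinity> = 0\<close>, which would admit weights vanishing on a square.\<close>

definition mult_infty :: "ennreal \<Rightarrow> ennreal \<Rightarrow> ennreal" where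
  "mult_infty x y = (if x = \<infinity> \<or> y = \<infinity> then \<infinity> else x * y)"

text \<open>Used only for exponents \<open>s > 0\<close>.\<close>

definition epowr :: "ennreal \<Rightarrow> real \<Rightarrow> ennreal" where
  "epowr x s = (if x = \<infinity> then \<infinity> else ennreal (enn2real x powr s))"

definition conj_exp :: "real \<Rightarrow> real" where
  "conj_exp p = p / (p - 1)"

text \<open>Negative powers of \<open>w\<close> are taken in \<^typ>\<open>ennreal\<close>, as \<^const>\<open>inverse\<close> of the positive
  power, so that they are \<open>\<infinity>\<close> where \<open>w\<close> vanishes (on the reals they would be \<open>0\<close> there).\<close>

definition Ap_restricted :: "real \<Rightarrow> (complex \<Rightarrow> real) set" where
  "Ap_restricted p = {w. weight w \<and>
     (\<exists>r>0. (SUP a. mult_infty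
        (avg (square a r) (\<lambda>z. ennreal (w z)))
        (epowr (avg (square a r) (\<lambda>z. inverse (ennreal (w z powr (conj_exp p / p)))))
               (p / conj_exp p))) < \<infinity>)}"

definition A1_restricted :: "(complex \<Rightarrow> real) set" where
  "A1_restricted = {w. weight w \<and>
     (\<exists>r>0. (SUP a. mult_infty
        (avg (square a r) (\<lambda>z. ennreal (w z)))
        (esssup (restrict_space lebesgue (square a r)) (\<lambda>z. inverse (ennreal (w z))))) < \<infinity>)}"

definition Ainf_restricted :: "(complex \<Rightarrow> real) set" where
  "Ainf_restricted = A1_restricted \<union> (\<Union>p\<in>{1<..}. Ap_restricted p)"

text \<open>For a weight \<open>w\<close> the mass of a disk is finite, so \<^const>\<open>enn2real\<close> loses nothing.\<close>

definition what :: "(complex \<Rightarrow> real) \<Rightarrow> complex \<Rightarrow> real" where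
  "what w z = enn2real (wmass w (ball z 1)) / measure lebesgue (ball z 1)"

definition fock_mass ::
    "real \<Rightarrow> real \<Rightarrow> (complex \<Rightarrow> real) \<Rightarrow> complex set \<Rightarrow> (complex \<Rightarrow> complex) \<Rightarrow> ennreal" where
  "fock_mass p \<alpha> v E f =
     (\<integral>\<^sup>+z\<in>E. ennreal (cmod (f z) powr p * exp (- (p * \<alpha> / 2) * (cmod z)\<^sup>2) * v z) \<partial>lebesgue)"

text \<open>\<open>fock_mass p \<alpha> v UNIV f\<close> is \<open>\<parallel>f\<parallel>\<^sup>p\<close>, the \<open>p\<close>-th power of the norm of \<open>f\<close>.\<close>

definition fock_space :: "real \<Rightarrow> real \<Rightarrow> (complex \<Rightarrow> real) \<Rightarrow> (complex \<Rightarrow> complex) set" where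
  "fock_space p \<alpha> v = {f. f holomorphic_on UNIV \<and> fock_mass p \<alpha> v UNIV f < \<infinity>}"

definition dominating :: "real \<Rightarrow> real \<Rightarrow> (complex \<Rightarrow> real) \<Rightarrow> complex set \<Rightarrow> bool" where
  "dominating p \<alpha> v G \<longleftrightarrow> G \<in> sets lebesgue \<and>
     (\<exists>C::real. C > 0 \<and>
        (\<forall>f\<in>fock_space p \<alpha> v. fock_mass p \<alpha> v UNIV f \<le> ennreal C * fock_mass p \<alpha> v G f))"

end

theory Submission
  imports Defs "HOL-Complex_Analysis.Complex_Analysis"
begin

text \<open>The restricted \<open>A\<^sub>\<infinity>\<close> condition makes the averaged weight comparable at neighbouring points, so it
  grows at most exponentially and relative density amounts to a lower bound for the Lebesgue measure
  of \<open>G\<close> in discs. If \<open>G\<close> is relatively dense, then on every disc whose double does not carry too much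
  more mass, the function, multiplied by a suitable exponential to flatten the Gaussian, belongs to a
  normal family, and Montel's theorem bounds its mass on the disc by its mass on \<open>G\<close>; the other discs
  carry at most half of the total mass. Conversely, a dominating set must capture mass of the normalised
  reproducing kernels, which is concentrated near their centres because the Gaussian beats the
  exponential growth of the weight.\<close>

subsection \<open>Sublevel sets of holomorphic functions\<close>

text \<open>The weight \<open>w\<close> may have zeros and unbounded peaks, so neither direction
  works with it directly: what enters about \<open>what w\<close> is measurability, positivity and
  one growth bound, \<open>what w z \<le> C ^ n * what w u\<close> for
  \<open>dist z u \<le> n\<close>. The obstacle is uniformity over the centres \<open>a\<close>.
  Montel's theorem gives no explicit constants, so every compactness argument must first be moved to
  a situation that no longer remembers \<open>a\<close>. Translation and scaling do this for
  sublevel sets. For the Gaussian, the cross term of \<open>|u|^2\<close> expanded about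
  \<open>a\<close> is the real part of a holomorphic function and can be moved into the entire
  function, after which the density on a disc of radius \<open>2 * R\<close> is pinched between two
  multiples of \<open>|g|^p\<close> whose ratio depends on neither \<open>a\<close> nor
  \<open>f\<close>. A normal family also needs a bound beyond the disc on which masses are compared;
  the doubling hypothesis supplies it, and discs without it are discarded by averaging, at the price
  of absorbing half of a mass that must be finite. Small exponents are allowed, so no step uses
  convexity of the \<open>p\<close>-th power.\<close>

lemma emeasure_lebesgue_ball_complex:
  fixes a :: complex
  assumes "0 \<le> r"
  shows "emeasure lebesgue (ball a r) = ennreal (pi * r\<^sup>2)"
  using assms by (simp add: emeasure_ball unit_ball_vol_2)

text \<open>By contradiction with levels \<open>1 / (n + 1)\<close>: Montel's theorem yields a limit
  whose zeros in \<open>cball 0 R\<close> would fill a set of measure at least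
  \<open>\<delta>\<close>. But the limit does not vanish identically there, so these zeros are
  finite in number. The margin \<open>R < R'\<close> makes the convergence uniform up to the
  boundary of the smaller disc.\<close>

lemma sublevel_measure_compactness:
  fixes R R' B \<delta> :: real
  assumes "0 < R" "R < R'" "0 < \<delta>"
  shows "\<exists>\<epsilon>>0. \<forall>g x. g holomorphic_on ball 0 R' \<and> (\<forall>z\<in>ball 0 R'. cmod (g z) \<le> B)
      \<and> x \<in> cball 0 R \<and> 1 \<le> cmod (g x)
    \<longrightarrow> emeasure lebesgue {z \<in> ball 0 R. cmod (g z) < \<epsilon>} \<le> ennreal \<delta>"
proof -
  define P where "P = (\<lambda>g x. g holomorphic_on ball 0 R' \<and> (\<forall>z\<in>ball 0 R'. cmod (g z) \<le> B)
    \<and> x \<in> cball 0 R \<and> 1 \<le> cmod (g x))"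
  have "\<exists>\<epsilon>>0. \<forall>g x. P g x \<longrightarrow> emeasure lebesgue {z \<in> ball 0 R. cmod (g z) < \<epsilon>} \<le> ennreal \<delta>"
  proof (rule ccontr)
    assume neg: "\<not> ?thesis"
    have neg': "\<exists>g x. P g x \<and> ennreal \<delta> < emeasure lebesgue {z \<in> ball 0 R. cmod (g z) < \<epsilon>}"
      if "0 < \<epsilon>" for \<epsilon>
      using neg that unfolding not_ex not_all de_Morgan_conj not_imp not_le by blast
    have "\<forall>n. \<exists>g x. P g x \<and>
        ennreal \<delta> < emeasure lebesgue {z \<in> ball 0 R. cmod (g z) < 1 / (real n + 1)}"
      by (intro allI neg') simp
    then obtain F X where FX: "\<And>n. P (F n) (X n)"
      and big: "\<And>n. ennreal \<delta> < emeasure lebesgue {z \<in> ball 0 R. cmod (F n z) < 1 / (real n + 1)}"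
      by metis
    obtain g r where g: "g holomorphic_on ball 0 R'" and r: "strict_mono (r :: nat \<Rightarrow> nat)"
      and unif: "\<And>K. \<lbrakk>compact K; K \<subseteq> ball 0 R'\<rbrakk> \<Longrightarrow> uniform_limit K (F \<circ> r) g sequentially"
    proof (rule Montel[of "ball 0 R'" "range F" F])
      show "\<exists>C. \<forall>h\<in>range F. \<forall>z\<in>K. cmod (h z) \<le> C" if "compact K" "K \<subseteq> ball 0 R'" for K
        using FX that unfolding P_def by blast
    next
      show "h holomorphic_on ball 0 R'" if "h \<in> range F" for h
        using FX that unfolding P_def by blast
    qed auto
    have sub: "cball 0 R \<subseteq> ball (0::complex) R'"
      using assms by auto
    have lim: "\<forall>\<^sub>F n in sequentially. \<forall>z\<in>cball 0 R. cmod (F (r n) z - g z) < e" if "0 < e" for e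
      using uniform_limitD[OF unif[OF compact_cball sub] that] by (simp add: dist_norm)
    have contg: "continuous_on (cball 0 R) g"
      using g holomorphic_on_imp_continuous_on holomorphic_on_subset sub by blast
    \<comment> \<open>The points \<open>X n\<close> move with \<open>n\<close>; uniform closeness
      \<open>1/2\<close> on the compact disc is enough, since
      \<open>cmod (F (r n) (X (r n)))\<close> is at least 1.\<close>
    have "\<not> (\<forall>z\<in>cball 0 R. g z = 0)"
    proof
      assume 0: "\<forall>z\<in>cball 0 R. g z = 0"
      obtain n where "\<forall>z\<in>cball 0 R. cmod (F (r n) z - g z) < 1/2"
        using lim[of "1/2"] by (auto simp: eventually_sequentially)
      then show False
        using FX[of "r n"] 0 unfolding P_def by force
    qed
    then obtain x0 where x0: "x0 \<in> cball 0 R" "g x0 \<noteq> 0" by blast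
    have zeros: "finite {z \<in> cball 0 R. g z = 0}"
    proof (cases "g constant_on ball 0 R'")
      case True
      then have "{z \<in> cball 0 R. g z = 0} = {}"
        using x0 sub unfolding constant_on_def by (metis (mono_tags, lifting) Collect_empty_eq subset_iff)
      then show ?thesis by (metis finite.emptyI)
    next
      case False
      then show ?thesis
        using holomorphic_compact_finite_zeros[OF g _ _ compact_cball sub] by auto
    qed
    \<comment> \<open>The level \<open>2 / (k + 1)\<close> leaves room for
      \<open>1 / (k + 1)\<close> from the sublevel set of \<open>F (r n)\<close> and
      \<open>1 / (k + 1)\<close> from the uniform error.\<close>
    define Z where "Z = (\<lambda>k::nat. {z \<in> cball 0 R. cmod (g z) \<le> 2 / (real k + 1)})"
    have Z_compact: "compact (Z k)" for k
    proof -
      have "Z k = cball 0 R \<inter> (\<lambda>z. cmod (g z)) -` {..2 / (real k + 1)}"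
        by (auto simp: Z_def)
      moreover have "closed (cball 0 R \<inter> (\<lambda>z. cmod (g z)) -` {..2 / (real k + 1)})"
        by (intro continuous_closed_preimage continuous_intros contg) auto
      ultimately show ?thesis
        by (metis bounded_cball bounded_Int compact_eq_bounded_closed)
    qed
    have Z_sets: "Z k \<in> sets lebesgue" for k
      using Z_compact by (meson lmeasurable_compact fmeasurableD)
    have "(\<lambda>k. emeasure lebesgue (Z k)) \<longlonglongrightarrow> emeasure lebesgue (\<Inter>k. Z k)"
    proof (rule Lim_emeasure_decseq)
      show "range Z \<subseteq> sets lebesgue" using Z_sets by auto
      show "decseq Z"
        unfolding decseq_def Z_def
        by (auto intro: order_trans[OF _ divide_left_mono])
      show "emeasure lebesgue (Z k) \<noteq> \<infinity>" for k
        unfolding infinity_ennreal_def by (rule fmeasurableD2[OF lmeasurable_compact[OF Z_compact]])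
    qed
    moreover have "(\<Inter>k. Z k) = {z \<in> cball 0 R. g z = 0}"
    proof (intro equalityI subsetI)
      fix z assume z: "z \<in> (\<Inter>k. Z k)"
      have "cmod (g z) \<le> 0"
      proof (rule LIMSEQ_le_const)
        show "(\<lambda>k. 2 / (real k + 1)) \<longlonglongrightarrow> 0" by real_asymp
      qed (use z in \<open>auto simp: Z_def\<close>)
      then show "z \<in> {z \<in> cball 0 R. g z = 0}" using z by (auto simp: Z_def)
    qed (auto simp: Z_def)
    moreover have "emeasure lebesgue {z \<in> cball 0 R. g z = 0} = 0"
      using negligible_finite[OF zeros] unfolding negligible_iff_null_sets by (rule null_setsD1)
    ultimately have "(\<lambda>k. emeasure lebesgue (Z k)) \<longlonglongrightarrow> 0" by simp
    then obtain k where k: "emeasure lebesgue (Z k) < ennreal \<delta>"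
      using order_tendstoD(2)[of _ 0 sequentially "ennreal \<delta>"] assms
      by (auto simp: eventually_sequentially)
    have "\<forall>\<^sub>F n in sequentially. k \<le> n \<and> (\<forall>z\<in>cball 0 R. cmod (F (r n) z - g z) < 1 / (real k + 1))"
      using lim[of "1 / (real k + 1)"] eventually_ge_at_top[of k]
      by (intro eventually_conj) auto
    then obtain n where n: "k \<le> n" "\<And>z. z \<in> cball 0 R \<Longrightarrow> cmod (F (r n) z - g z) < 1 / (real k + 1)"
      by (auto simp: eventually_sequentially)
    have "{z \<in> ball 0 R. cmod (F (r n) z) < 1 / (real (r n) + 1)} \<subseteq> Z k"
    proof clarify
      fix z assume z: "z \<in> ball 0 R" "cmod (F (r n) z) < 1 / (real (r n) + 1)"
      have "k \<le> r n" using n(1) seq_suble[OF r, of n] by linarith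
      then have "1 / (real (r n) + 1) \<le> 1 / (real k + 1)" by (simp add: frac_le)
      moreover have "cmod (g z) \<le> cmod (F (r n) z) + cmod (F (r n) z - g z)"
        by (metis norm_minus_commute norm_triangle_sub)
      ultimately have "cmod (g z) \<le> 1 / (real k + 1) + 1 / (real k + 1)"
        using z n(2)[of z] by auto
      then show "z \<in> Z k" using z by (auto simp: Z_def field_simps)
    qed
    then have "emeasure lebesgue {z \<in> ball 0 R. cmod (F (r n) z) < 1 / (real (r n) + 1)} < ennreal \<delta>"
      using k emeasure_mono[OF _ Z_sets] by (meson le_less_trans)
    from this big[of "r n"] show False by (rule less_asym)
  qed
  then show ?thesis unfolding P_def .
qed

text \<open>Affine rescaling of the compactness bound and division by \<open>M\<close>: one
  \<open>\<epsilon>\<close> serves all centres, scales and heights. The free scale \<open>s\<close>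
  is for discs whose radius depends on the function.\<close>

lemma remez_type_estimate:
  fixes R R' B \<delta> :: real
  assumes "0 < R" "R < R'" "0 < \<delta>"
  shows "\<exists>\<epsilon>>0. \<forall>g a s M x. 0 < s \<and> 0 < M \<and> g holomorphic_on ball a (s * R')
      \<and> (\<forall>z\<in>ball a (s * R'). cmod (g z) \<le> B * M) \<and> x \<in> cball a (s * R) \<and> M \<le> cmod (g x)
    \<longrightarrow> emeasure lebesgue {z \<in> ball a (s * R). cmod (g z) < \<epsilon> * M} \<le> ennreal (s\<^sup>2 * \<delta>)"
proof -
  obtain \<epsilon> where \<epsilon>: "0 < \<epsilon>"
    and *: "\<And>g x. g holomorphic_on ball 0 R' \<and> (\<forall>z\<in>ball 0 R'. cmod (g z) \<le> B) \<and>
       x \<in> cball 0 R \<and> 1 \<le> cmod (g x)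
     \<Longrightarrow> emeasure lebesgue {z \<in> ball 0 R. cmod (g z) < \<epsilon>} \<le> ennreal \<delta>"
    using sublevel_measure_compactness[OF assms, of B] by blast
  show ?thesis
  proof (intro exI conjI allI impI, rule \<epsilon>, elim conjE)
    fix g and a x :: complex and s M :: real
    assume s: "0 < s" and M: "0 < M" and g: "g holomorphic_on ball a (s * R')"
      and B: "\<forall>z\<in>ball a (s * R'). cmod (g z) \<le> B * M"
      and x: "x \<in> cball a (s * R)" "M \<le> cmod (g x)"
    define T where "T = (\<lambda>u::complex. s *\<^sub>R u + a)"
    define h where "h = (\<lambda>u. g (T u) / M)"
    have T_ball: "T u \<in> ball a (s * \<rho>) \<longleftrightarrow> u \<in> ball 0 \<rho>" for u \<rho>
      using s by (auto simp: T_def dist_norm)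
    have inv: "T ((x - a) /\<^sub>R s) = x" for x using s by (simp add: T_def)
    have "h holomorphic_on ball 0 R'"
      unfolding h_def
    proof (intro holomorphic_intros holomorphic_on_compose_gen[OF _ g, unfolded o_def])
      show "T holomorphic_on ball 0 R'"
        unfolding T_def scaleR_conv_of_real by (intro holomorphic_intros)
      show "T ` ball 0 R' \<subseteq> ball a (s * R')" using T_ball by auto
    qed (use M in auto)
    moreover have "cmod (h u) \<le> B" if "u \<in> ball 0 R'" for u
      using bspec[OF B, of "T u"] that M T_ball by (simp add: h_def norm_divide divide_le_eq)
    moreover have "(x - a) /\<^sub>R s \<in> cball 0 R"
      using x s by (simp add: dist_norm norm_minus_commute divide_simps mult.commute)
    moreover have "1 \<le> cmod (h ((x - a) /\<^sub>R s))"
      using x M by (simp add: h_def inv norm_divide)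
    ultimately have "emeasure lebesgue {z \<in> ball 0 R. cmod (h z) < \<epsilon>} \<le> ennreal \<delta>"
      by (intro * conjI ballI)
    moreover have "{z \<in> ball a (s * R). cmod (g z) < \<epsilon> * M} = T ` {z \<in> ball 0 R. cmod (h z) < \<epsilon>}"
    proof (intro equalityI subsetI)
      fix z assume z: "z \<in> {z \<in> ball a (s * R). cmod (g z) < \<epsilon> * M}"
      then have "(z - a) /\<^sub>R s \<in> {z \<in> ball 0 R. cmod (h z) < \<epsilon>}"
        using M T_ball[of "(z - a) /\<^sub>R s" R] unfolding inv
        by (simp add: h_def inv norm_divide divide_less_eq)
      then show "z \<in> T ` {z \<in> ball 0 R. cmod (h z) < \<epsilon>}" by (intro image_eqI[where x="(z - a) /\<^sub>R s"]) (simp_all only: inv)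
    next
      fix z assume "z \<in> T ` {z \<in> ball 0 R. cmod (h z) < \<epsilon>}"
      then show "z \<in> {z \<in> ball a (s * R). cmod (g z) < \<epsilon> * M}"
        using T_ball M by (auto simp: h_def norm_divide divide_less_eq)
    qed
    ultimately show "emeasure lebesgue {z \<in> ball a (s * R). cmod (g z) < \<epsilon> * M} \<le> ennreal (s\<^sup>2 * \<delta>)"
      unfolding T_def using s assms
      by (simp add: emeasure_lebesgue_affine ennreal_mult ennreal_power mult_left_mono)
  qed
qed

subsection \<open>Local mass estimates\<close>

lemma emeasure_Diff_ge_half:
  assumes "E \<in> sets M" "L \<in> sets M" "0 \<le> \<eta>"
    and "ennreal (2 * \<eta>) \<le> emeasure M E" "emeasure M L \<le> ennreal \<eta>"
  shows "ennreal \<eta> \<le> emeasure M (E - L)"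
proof -
  have "emeasure M E \<le> emeasure M (L \<union> (E - L))"
    using assms by (intro emeasure_mono) auto
  also have "\<dots> \<le> emeasure M L + emeasure M (E - L)"
    using assms by (intro emeasure_subadditive) auto
  also have "\<dots> \<le> ennreal \<eta> + emeasure M (E - L)"
    using assms by (intro add_mono) auto
  finally have "ennreal \<eta> + ennreal \<eta> \<le> ennreal \<eta> + emeasure M (E - L)"
    using assms by (simp add: ennreal_plus[symmetric] del: ennreal_plus)
  then show ?thesis by (simp add: ennreal_add_left_cancel_le)
qed

text \<open>Chebyshev's inequality on the part of \<open>E\<close> where
  \<open>cmod (g z) \<ge> m\<close>: the sublevel set takes away at most half of the guaranteed
  measure \<open>2 * \<eta>\<close>.\<close>

lemma superlevel_integral_bound:
  fixes g :: "complex \<Rightarrow> complex"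
  assumes E: "E \<in> sets lebesgue" "E \<subseteq> ball a \<rho>" and g: "continuous_on (ball a \<rho>) g"
    and pos: "0 \<le> m" "0 < p" "0 \<le> \<eta>"
    and big: "ennreal (2 * \<eta>) \<le> emeasure lebesgue E"
    and small: "emeasure lebesgue {z \<in> ball a \<rho>. cmod (g z) < m} \<le> ennreal \<eta>"
  shows "ennreal (m powr p * \<eta>) \<le> (\<integral>\<^sup>+z\<in>E. ennreal (cmod (g z) powr p) \<partial>lebesgue)"
proof -
  define L where "L = {z \<in> ball a \<rho>. cmod (g z) < m}"
  have "L = ball a \<rho> \<inter> (\<lambda>z. cmod (g z)) -` {..<m}" by (auto simp: L_def)
  moreover have "open (ball a \<rho> \<inter> (\<lambda>z. cmod (g z)) -` {..<m})"
    by (intro continuous_open_preimage continuous_intros g) auto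
  ultimately have L: "L \<in> sets lebesgue" by auto
  have \<eta>: "ennreal \<eta> \<le> emeasure lebesgue (E - L)"
    using small by (intro emeasure_Diff_ge_half[OF E(1) L pos(3) big]) (simp add: L_def)
  have "ennreal (m powr p * \<eta>) \<le> ennreal (m powr p) * emeasure lebesgue (E - L)"
    using \<eta> by (simp add: ennreal_mult' mult_left_mono)
  also have "\<dots> = (\<integral>\<^sup>+z. ennreal (m powr p) * indicator (E - L) z \<partial>lebesgue)"
    using E L by (intro nn_integral_cmult_indicator[symmetric]) auto
  also have "\<dots> \<le> (\<integral>\<^sup>+z\<in>E. ennreal (cmod (g z) powr p) \<partial>lebesgue)"
    using E pos by (intro nn_integral_mono)
      (auto simp: indicator_def L_def not_less intro!: ennreal_leI powr_mono2)
  finally show ?thesis .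
qed

text \<open>Rescaling \<^term>\<open>f\<close> around the maximum of
  \<open>\<lambda>u. cmod (f u) * (r - dist z u) powr (2 / p)\<close> gives a function that is bounded on the unit disc
  and has value 1 at the centre; this replaces the subharmonicity of \<open>\<lambda>u. cmod (f u) powr p\<close>.\<close>

lemma entire_sub_mean_value:
  fixes p r :: real
  assumes p: "0 < p" and r: "0 < r"
  shows "\<exists>C>0. \<forall>f z. f holomorphic_on UNIV \<longrightarrow>
    ennreal (cmod (f z) powr p) \<le> ennreal C * (\<integral>\<^sup>+u\<in>ball z r. ennreal (cmod (f u) powr p) \<partial>lebesgue)"
proof -
  \<comment> \<open>On the disc about \<open>z0\<close> of half its distance \<open>d\<close> to the
    boundary, the factor \<open>(r - dist z u) powr (2 / p)\<close> falls below its value at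
    \<open>z0\<close> by at most \<open>2 powr (2 / p)\<close>, so maximality at \<open>z0\<close>
    turns into \<open>cmod (f v) \<le> B * M\<close>.\<close>
  define B :: real where "B = 2 powr (2 / p)"
  \<comment> \<open>\<open>pi / 8\<close> is half of the area of the disc of radius
    \<open>1/2\<close>.\<close>
  have h: "(0::real) < 1/2" "(1/2::real) < 1" "0 < pi / 8" by auto
  obtain \<epsilon> where \<epsilon>: "0 < \<epsilon>" and remez: "\<And>g a s M x. 0 < s \<and> 0 < M \<and> g holomorphic_on ball a (s * 1)
      \<and> (\<forall>z\<in>ball a (s * 1). cmod (g z) \<le> B * M) \<and> x \<in> cball a (s * (1/2)) \<and> M \<le> cmod (g x)
    \<Longrightarrow> emeasure lebesgue {z \<in> ball a (s * (1/2)). cmod (g z) < \<epsilon> * M} \<le> ennreal (s\<^sup>2 * (pi / 8))"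
    using remez_type_estimate[of "1/2" 1 "pi/8" B, OF h(1,2,3)] by blast
  \<comment> \<open>Compares \<open>cmod (f z) powr p * r\<^sup>2 \<le> M powr p * d\<^sup>2\<close>
    with the lower bound \<open>(\<epsilon> * M) powr p * pi * d\<^sup>2 / 32\<close> for the
    integral.\<close>
  define C where "C = 32 / (pi * r\<^sup>2 * \<epsilon> powr p)"
  have C: "0 < C" using \<epsilon> r by (simp add: C_def)
  show ?thesis
  proof (intro exI conjI allI impI, rule C)
    fix f and z :: complex
    assume f: "f holomorphic_on UNIV"
    have contf: "continuous_on X f" for X
      using f holomorphic_on_imp_continuous_on continuous_on_subset by blast
    \<comment> \<open>With the exponent \<open>2 / p\<close>, the \<open>p\<close>-th power of the
      second factor is the squared distance, which matches the area of a disc of radius proportional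
      to \<open>d\<close>; this lets the unknown \<open>d\<close> cancel.\<close>
    define \<phi> where "\<phi> = (\<lambda>u. cmod (f u) * (r - dist z u) powr (2 / p))"
    have "continuous_on (cball z r) \<phi>"
      unfolding \<phi>_def using p
      by (intro continuous_intros contf continuous_on_powr') auto
    then obtain z0 where z0: "z0 \<in> cball z r" and max: "\<And>u. u \<in> cball z r \<Longrightarrow> \<phi> u \<le> \<phi> z0"
      using continuous_attains_sup[of "cball z r" \<phi>] r by auto
    define d where "d = r - dist z z0"
    define M where "M = cmod (f z0)"
    define J where "J = (\<integral>\<^sup>+u\<in>ball z r. ennreal (cmod (f u) powr p) \<partial>lebesgue)"
    have \<phi>z: "cmod (f z) * r powr (2 / p) \<le> M * d powr (2 / p)"
      using max[of z] r by (simp add: \<phi>_def d_def M_def)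
    have powr2: "(x * y powr (2 / p)) powr p = x powr p * y\<^sup>2" if "0 \<le> x" "0 \<le> y" for x y :: real
      using that p by (simp add: powr_mult powr_powr flip: powr_numeral)
    show "ennreal (cmod (f z) powr p) \<le> ennreal C * J"
    proof (cases "M = 0 \<or> d \<le> 0")
      case True
      then have "M * d powr (2 / p) = 0"
        using z0 by (auto simp: d_def)
      then have "cmod (f z) * r powr (2 / p) \<le> 0" using \<phi>z by linarith
      then have "f z = 0" using r by (simp add: mult_le_0_iff)
      then show ?thesis by simp
    next
      case False
      then have M: "0 < M" and d: "0 < d" by (auto simp: M_def)
      have near: "r - dist z v \<ge> d / 2" "v \<in> ball z r" if "v \<in> ball z0 (d / 2)" for v
        using that d dist_triangle[of z v z0] by (auto simp: d_def dist_commute)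
      have bnd: "cmod (f v) \<le> B * M" if v: "v \<in> ball z0 (d / 2)" for v
      proof -
        have "cmod (f v) * (d / 2) powr (2 / p) \<le> \<phi> v"
          unfolding \<phi>_def using near[OF v] d p by (intro mult_left_mono powr_mono2) auto
        also have "\<dots> \<le> M * d powr (2 / p)"
          using max[of v] near[OF v] by (simp add: \<phi>_def d_def M_def)
        also have "\<dots> = (B * M) * (d / 2) powr (2 / p)"
          using d by (simp add: B_def powr_divide)
        finally show ?thesis using d by simp
      qed
      have small: "emeasure lebesgue {v \<in> ball z0 (d/2 * (1/2)). cmod (f v) < \<epsilon> * M}
          \<le> ennreal ((d/2)\<^sup>2 * (pi / 8))"
        using d M bnd f by (intro remez[where x = z0]) (auto simp: M_def intro: holomorphic_on_subset)
      have big: "ennreal (2 * ((d/2)\<^sup>2 * (pi / 8))) \<le> emeasure lebesgue (ball z0 (d/2 * (1/2)))"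
        using d by (subst emeasure_lebesgue_ball_complex) (auto simp: power2_eq_square intro!: ennreal_leI)
      have "ennreal ((\<epsilon> * M) powr p * ((d/2)\<^sup>2 * (pi / 8)))
          \<le> (\<integral>\<^sup>+u\<in>ball z0 (d/2 * (1/2)). ennreal (cmod (f u) powr p) \<partial>lebesgue)"
      proof (rule superlevel_integral_bound[OF _ subset_refl contf _ p _ big small])
        show "0 \<le> \<epsilon> * M" using M \<epsilon> by simp
      qed auto
      also have "\<dots> \<le> J"
        unfolding J_def using near d by (intro nn_integral_mono) (auto simp: indicator_def)
      finally have J: "ennreal ((\<epsilon> * M) powr p * ((d/2)\<^sup>2 * (pi / 8))) \<le> J" .
      have "cmod (f z) powr p * r\<^sup>2 \<le> M powr p * d\<^sup>2"
        using powr_mono2[OF _ _ \<phi>z, of p] p r d M by (simp add: powr2)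
      then have "cmod (f z) powr p \<le> C * ((\<epsilon> * M) powr p * ((d/2)\<^sup>2 * (pi / 8)))"
        using r \<epsilon> M by (simp add: C_def powr_mult power_divide field_simps)
      then have "ennreal (cmod (f z) powr p) \<le> ennreal C * ennreal ((\<epsilon> * M) powr p * ((d/2)\<^sup>2 * (pi / 8)))"
        using C by (simp add: ennreal_mult' flip: ennreal_mult'')
      also have "\<dots> \<le> ennreal C * J" using J by (intro mult_left_mono) auto
      finally show ?thesis .
    qed
  qed
qed

text \<open>Let \<open>M\<close> be the maximum of \<open>cmod (g u)\<close> on
  \<open>cball a R\<close>. The doubling hypothesis and the mean value bound give
  \<open>cmod (g z) \<le> B * M\<close> on the disc of radius \<open>3/2 * R\<close>. Hence
  \<open>cmod (g z) \<ge> \<epsilon> * M\<close> on a part of \<open>E\<close> of measure at least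
  \<open>\<eta> / 2\<close>, while the integral over \<open>ball a R\<close> is at most
  \<open>M powr p * (pi * R\<^sup>2)\<close>.\<close>

lemma local_logvinenko_sereda:
  fixes p R \<eta> K :: real
  assumes p: "0 < p" and R: "0 < R" and \<eta>: "0 < \<eta>" and K: "0 < K"
  shows "\<exists>c>0. \<forall>g a E. g holomorphic_on UNIV \<and> E \<in> sets lebesgue \<and> E \<subseteq> ball a R
      \<and> ennreal \<eta> \<le> emeasure lebesgue E
      \<and> (\<integral>\<^sup>+u\<in>ball a (2 * R). ennreal (cmod (g u) powr p) \<partial>lebesgue)
          \<le> ennreal K * (\<integral>\<^sup>+u\<in>ball a R. ennreal (cmod (g u) powr p) \<partial>lebesgue)
    \<longrightarrow> (\<integral>\<^sup>+u\<in>ball a R. ennreal (cmod (g u) powr p) \<partial>lebesgue)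
          \<le> ennreal c * (\<integral>\<^sup>+u\<in>E. ennreal (cmod (g u) powr p) \<partial>lebesgue)"
proof -
  obtain C where C: "0 < C" and smv: "\<And>f z. f holomorphic_on UNIV \<Longrightarrow>
      ennreal (cmod (f z) powr p) \<le> ennreal C * (\<integral>\<^sup>+u\<in>ball z (R/2). ennreal (cmod (f u) powr p) \<partial>lebesgue)"
    using entire_sub_mean_value[OF p, of "R/2"] R by auto
  define B where "B = (C * K * (pi * R\<^sup>2)) powr (1 / p)"
  \<comment> \<open>The intermediate radius \<open>3/2 * R\<close> exceeds \<open>R\<close>, and
    discs of radius \<open>R/2\<close> about points of that larger disc stay inside
    \<open>ball a (2 * R)\<close>.\<close>
  have h: "0 < R" "R < 3/2 * R" "0 < \<eta> / 2" using R \<eta> by auto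
  obtain \<epsilon> where \<epsilon>: "0 < \<epsilon>" and remez: "\<And>g a s M x. 0 < s \<and> 0 < M \<and> g holomorphic_on ball a (s * (3/2 * R))
      \<and> (\<forall>z\<in>ball a (s * (3/2 * R)). cmod (g z) \<le> B * M) \<and> x \<in> cball a (s * R) \<and> M \<le> cmod (g x)
    \<Longrightarrow> emeasure lebesgue {z \<in> ball a (s * R). cmod (g z) < \<epsilon> * M} \<le> ennreal (s\<^sup>2 * (\<eta> / 2))"
    using remez_type_estimate[of R "3/2 * R" "\<eta>/2" B, OF h(1,2,3)] by blast
  define c where "c = 2 * pi * R\<^sup>2 / (\<epsilon> powr p * \<eta>)"
  have c: "0 < c" using \<epsilon> \<eta> R by (simp add: c_def)
  show ?thesis
  proof (intro exI conjI allI impI, rule c, elim conjE)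
    fix g :: "complex \<Rightarrow> complex" and a :: complex and E
    let ?I = "\<lambda>A. (\<integral>\<^sup>+u\<in>A. ennreal (cmod (g u) powr p) \<partial>lebesgue)"
    assume g: "g holomorphic_on UNIV" and E: "E \<in> sets lebesgue" "E \<subseteq> ball a R"
      "ennreal \<eta> \<le> emeasure lebesgue E" and good: "?I (ball a (2 * R)) \<le> ennreal K * ?I (ball a R)"
    have contg: "continuous_on X g" for X
      using g holomorphic_on_imp_continuous_on continuous_on_subset by blast
    obtain x where x: "x \<in> cball a R" and max: "\<And>u. u \<in> cball a R \<Longrightarrow> cmod (g u) \<le> cmod (g x)"
      using continuous_attains_sup[of "cball a R" "\<lambda>u. cmod (g u)"] R
        continuous_on_norm[OF contg, of "cball a R"] by auto
    define M where "M = cmod (g x)"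
    have "?I (ball a R) \<le> (\<integral>\<^sup>+u. ennreal (M powr p) * indicator (ball a R) u \<partial>lebesgue)"
      using max p by (intro nn_integral_mono)
        (auto simp: indicator_def M_def intro!: ennreal_leI powr_mono2)
    also have "\<dots> = ennreal (M powr p * (pi * R\<^sup>2))"
      using R emeasure_lebesgue_ball_complex[of R a]
      by (subst nn_integral_cmult_indicator) (simp_all add: ennreal_mult')
    finally have I_le: "?I (ball a R) \<le> ennreal (M powr p * (pi * R\<^sup>2))" .
    show "?I (ball a R) \<le> ennreal c * ?I E"
    proof (cases "M = 0")
      case True
      then show ?thesis using I_le by simp
    next
      case False
      then have M: "0 < M" by (simp add: M_def)
      have bnd: "cmod (g z) \<le> B * M" if z: "z \<in> ball a (3/2 * R)" for z
      proof -
        have "ball z (R/2) \<subseteq> ball a (2 * R)"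
        proof
          fix u assume "u \<in> ball z (R/2)"
          then show "u \<in> ball a (2 * R)" using z dist_triangle[of a u z] by auto
        qed
        then have sub: "?I (ball z (R/2)) \<le> ?I (ball a (2 * R))"
          by (intro nn_integral_mono) (auto simp: indicator_def)
        have "ennreal (cmod (g z) powr p) \<le> ennreal C * ?I (ball z (R/2))"
          by (rule smv[OF g])
        also have "\<dots> \<le> ennreal C * (ennreal K * ennreal (M powr p * (pi * R\<^sup>2)))"
          using order_trans[OF sub order_trans[OF good mult_left_mono[OF I_le]]]
          by (intro mult_left_mono) auto
        also have "\<dots> = ennreal ((C * K * (pi * R\<^sup>2)) * M powr p)"
          using C K by (simp add: mult_ac flip: ennreal_mult')
        finally have "cmod (g z) powr p \<le> (C * K * (pi * R\<^sup>2)) * M powr p"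
          using C K by (simp add: ennreal_le_iff)
        then have "(cmod (g z) powr p) powr (1 / p) \<le> ((C * K * (pi * R\<^sup>2)) * M powr p) powr (1 / p)"
          using p by (intro powr_mono2) auto
        then show ?thesis
          using p C K M by (simp add: B_def powr_powr powr_mult)
      qed
      have small: "emeasure lebesgue {z \<in> ball a R. cmod (g z) < \<epsilon> * M} \<le> ennreal (\<eta> / 2)"
        using remez[of 1 M g a x] M bnd g x by (auto simp: M_def intro: holomorphic_on_subset)
      have big: "ennreal (2 * (\<eta> / 2)) \<le> emeasure lebesgue E"
        using E(3) by simp
      have "ennreal ((\<epsilon> * M) powr p * (\<eta> / 2)) \<le> ?I E"
      proof (rule superlevel_integral_bound[OF E(1,2) contg _ p _ big small])
        show "0 \<le> \<epsilon> * M" using M \<epsilon> by simp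
      qed (use \<eta> in auto)
      then have "ennreal c * ennreal ((\<epsilon> * M) powr p * (\<eta> / 2)) \<le> ennreal c * ?I E"
        by (intro mult_left_mono) auto
      moreover have "M powr p * (pi * R\<^sup>2) = c * ((\<epsilon> * M) powr p * (\<eta> / 2))"
        using \<epsilon> \<eta> M by (simp add: c_def powr_mult field_simps)
      then have "?I (ball a R) \<le> ennreal c * ennreal ((\<epsilon> * M) powr p * (\<eta> / 2))"
        using I_le by (simp only: ennreal_mult'[OF less_imp_le[OF c]])
      ultimately show ?thesis by (rule order_trans[rotated])
    qed
  qed
qed

subsection \<open>Averaging over discs\<close>

text \<open>Tonelli: a point \<open>z\<close> belongs to exactly those \<open>ball a R\<close> with
  centre in \<open>ball z R\<close>, a set of area \<open>pi * R\<^sup>2\<close>.\<close>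

lemma nn_integral_ball_average:
  fixes h :: "complex \<Rightarrow> ennreal"
  assumes h: "h \<in> borel_measurable lebesgue" and R: "0 \<le> R"
  shows measurable_ball_average: "(\<lambda>a. \<integral>\<^sup>+z\<in>ball a R. h z \<partial>lebesgue) \<in> borel_measurable borel"
    and "(\<integral>\<^sup>+a. (\<integral>\<^sup>+z\<in>ball a R. h z \<partial>lebesgue) \<partial>lebesgue)
      = ennreal (pi * R\<^sup>2) * (\<integral>\<^sup>+z. h z \<partial>lebesgue)"
proof -
  \<comment> \<open>\<open>h\<close> is measurable only for the completion, while Tonelli is applied
    to \<open>lborel\<close> in both variables; the Borel version \<open>h'\<close> has the same
    integral over every disc.\<close>
  obtain h' where h'[measurable]: "h' \<in> borel_measurable lborel" and ae: "AE z in lborel. h z = h' z"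
    using completion_ex_borel_measurable[OF h] by blast
  define k where "k = (\<lambda>a z. h' z * indicator {q. dist (fst q) (snd q) < R} (a, z))"
  have "open {q::complex \<times> complex. dist (fst q) (snd q) < R}"
    by (intro open_Collect_less continuous_intros)
  then have [measurable]: "{q::complex \<times> complex. dist (fst q) (snd q) < R} \<in> sets (lborel \<Otimes>\<^sub>M lborel)"
    unfolding lborel_prod by simp
  have k: "case_prod k \<in> borel_measurable (lborel \<Otimes>\<^sub>M lborel)"
    unfolding k_def by measurable
  have eq: "(\<integral>\<^sup>+z\<in>ball a R. h z \<partial>lebesgue) = (\<integral>\<^sup>+z. k a z \<partial>lborel)" for a
    unfolding nn_integral_completion
    by (rule nn_integral_cong_AE) (use ae in \<open>auto simp: k_def indicator_def\<close>)
  show "(\<lambda>a. \<integral>\<^sup>+z\<in>ball a R. h z \<partial>lebesgue) \<in> borel_measurable borel"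
    unfolding eq using lborel.borel_measurable_nn_integral[OF k] by simp
  have inner: "(\<integral>\<^sup>+a. k a z \<partial>lborel) = ennreal (pi * R\<^sup>2) * h' z" for z
  proof -
    have "(\<integral>\<^sup>+a. k a z \<partial>lborel) = (\<integral>\<^sup>+a. h' z * indicator (ball z R) a \<partial>lborel)"
      by (intro nn_integral_cong) (auto simp: k_def indicator_def dist_commute)
    also have "\<dots> = h' z * ennreal (pi * R\<^sup>2)"
      using emeasure_lebesgue_ball_complex[OF R, of z] by (simp add: nn_integral_cmult_indicator)
    finally show ?thesis by (simp add: mult.commute)
  qed
  have "(\<integral>\<^sup>+a. (\<integral>\<^sup>+z\<in>ball a R. h z \<partial>lebesgue) \<partial>lebesgue) = (\<integral>\<^sup>+a. (\<integral>\<^sup>+z. k a z \<partial>lborel) \<partial>lborel)"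
    unfolding eq by (rule nn_integral_completion)
  also have "\<dots> = (\<integral>\<^sup>+z. (\<integral>\<^sup>+a. k a z \<partial>lborel) \<partial>lborel)"
    by (rule lborel_pair.Fubini'[OF k, symmetric])
  also have "\<dots> = ennreal (pi * R\<^sup>2) * (\<integral>\<^sup>+z. h' z \<partial>lborel)"
    unfolding inner by (rule nn_integral_cmult) simp
  also have "(\<integral>\<^sup>+z. h' z \<partial>lborel) = (\<integral>\<^sup>+z. h z \<partial>lebesgue)"
    unfolding nn_integral_completion by (rule nn_integral_cong_AE) (use ae in auto)
  finally show "(\<integral>\<^sup>+a. (\<integral>\<^sup>+z\<in>ball a R. h z \<partial>lebesgue) \<partial>lebesgue)
      = ennreal (pi * R\<^sup>2) * (\<integral>\<^sup>+z. h z \<partial>lebesgue)" .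
qed

text \<open>Discs whose concentric double has more than 8 times their mass carry at most half of the
  total mass, since doubling the radius multiplies the averaged mass by 4 only.\<close>

lemma good_disc_averaging:
  fixes h :: "complex \<Rightarrow> ennreal"
  assumes h[measurable]: "h \<in> borel_measurable lebesgue" and fin: "(\<integral>\<^sup>+z. h z \<partial>lebesgue) < \<infinity>"
    and G[measurable]: "G \<in> sets lebesgue" and R: "0 < R" and c: "0 < c"
    and good: "\<And>a. (\<integral>\<^sup>+z\<in>ball a (2 * R). h z \<partial>lebesgue) \<le> 8 * (\<integral>\<^sup>+z\<in>ball a R. h z \<partial>lebesgue)
      \<Longrightarrow> (\<integral>\<^sup>+z\<in>ball a R. h z \<partial>lebesgue) \<le> ennreal c * (\<integral>\<^sup>+z\<in>G \<inter> ball a R. h z \<partial>lebesgue)"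
  shows "(\<integral>\<^sup>+z. h z \<partial>lebesgue) \<le> ennreal (2 * c) * (\<integral>\<^sup>+z\<in>G. h z \<partial>lebesgue)"
proof -
  define hG where "hG = (\<lambda>z. h z * indicator G z)"
  have hG: "hG \<in> borel_measurable lebesgue" unfolding hG_def by measurable
  define I where "I = enn2real (\<integral>\<^sup>+z. h z \<partial>lebesgue)"
  have I: "(\<integral>\<^sup>+z. h z \<partial>lebesgue) = ennreal I" "0 \<le> I" using fin by (auto simp: I_def)
  have "(\<integral>\<^sup>+z. hG z \<partial>lebesgue) \<le> (\<integral>\<^sup>+z. h z \<partial>lebesgue)"
    by (intro nn_integral_mono) (auto simp: hG_def indicator_def)
  then have finG: "(\<integral>\<^sup>+z. hG z \<partial>lebesgue) < \<infinity>" using fin by (rule le_less_trans)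
  define IG where "IG = enn2real (\<integral>\<^sup>+z. hG z \<partial>lebesgue)"
  have IG: "(\<integral>\<^sup>+z. hG z \<partial>lebesgue) = ennreal IG" "0 \<le> IG" using finG by (auto simp: IG_def)
  have hG_ball: "(\<integral>\<^sup>+z\<in>G \<inter> ball a R. h z \<partial>lebesgue) = (\<integral>\<^sup>+z\<in>ball a R. hG z \<partial>lebesgue)" for a
    by (intro nn_integral_cong) (auto simp: hG_def indicator_def)
  \<comment> \<open>One inequality for all discs: the first term covers those to which
    \<open>good\<close> applies, the second covers the others.\<close>
  have pt: "(\<integral>\<^sup>+z\<in>ball a R. h z \<partial>lebesgue) \<le> ennreal c * (\<integral>\<^sup>+z\<in>ball a R. hG z \<partial>lebesgue)
      + ennreal (1/8) * (\<integral>\<^sup>+z\<in>ball a (2 * R). h z \<partial>lebesgue)" (is "?A \<le> ?B + _ * ?C") for a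
  proof (cases "?C \<le> 8 * ?A")
    case True
    then show ?thesis
      using good[of a] unfolding hG_ball by (meson add_increasing2 order_trans zero_le)
  next
    case False
    then have "ennreal (1/8) * (8 * ?A) \<le> ennreal (1/8) * ?C"
      by (intro mult_left_mono) auto
    moreover have "ennreal (1/8) * (8 * ?A) = ?A"
    proof -
      have "ennreal (1/8) * 8 = ennreal (1/8) * ennreal 8" by simp
      also have "\<dots> = 1" by (subst ennreal_mult'[symmetric]) auto
      finally have eighth: "ennreal (1/8) * 8 = 1" .
      show ?thesis unfolding mult.assoc[symmetric] eighth by simp
    qed
    ultimately have "?A \<le> ennreal (1/8) * ?C" by simp
    then show ?thesis by (rule add_increasing[OF zero_le])
  qed
  have meas: "(\<lambda>a. \<integral>\<^sup>+z\<in>ball a \<rho>. k z \<partial>lebesgue) \<in> borel_measurable lebesgue"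
    if "k \<in> borel_measurable lebesgue" "0 < \<rho>" for k :: "complex \<Rightarrow> ennreal" and \<rho>
    using measurable_ball_average[OF that(1), of \<rho>] that(2)
    by (intro measurable_completion) simp
  have "ennreal (pi * R\<^sup>2) * ennreal I = (\<integral>\<^sup>+a. (\<integral>\<^sup>+z\<in>ball a R. h z \<partial>lebesgue) \<partial>lebesgue)"
    using nn_integral_ball_average(2)[OF h, of R] R by (simp add: I)
  also have "\<dots> \<le> (\<integral>\<^sup>+a. ennreal c * (\<integral>\<^sup>+z\<in>ball a R. hG z \<partial>lebesgue)
      + ennreal (1/8) * (\<integral>\<^sup>+z\<in>ball a (2 * R). h z \<partial>lebesgue) \<partial>lebesgue)"
    by (intro nn_integral_mono pt)
  also have "\<dots> = ennreal c * (\<integral>\<^sup>+a. (\<integral>\<^sup>+z\<in>ball a R. hG z \<partial>lebesgue) \<partial>lebesgue)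
      + ennreal (1/8) * (\<integral>\<^sup>+a. (\<integral>\<^sup>+z\<in>ball a (2 * R). h z \<partial>lebesgue) \<partial>lebesgue)"
    using meas[OF hG, of R] meas[OF h, of "2 * R"] R
    by (simp add: nn_integral_add nn_integral_cmult)
  also have "\<dots> = ennreal c * (ennreal (pi * R\<^sup>2) * ennreal IG)
      + ennreal (1/8) * (ennreal (pi * (2 * R)\<^sup>2) * ennreal I)"
    using nn_integral_ball_average(2)[OF hG, of R] nn_integral_ball_average(2)[OF h, of "2 * R"] R
    by (simp add: I IG)
  also have "\<dots> = ennreal (c * (pi * R\<^sup>2 * IG) + 1/8 * (pi * (2 * R)\<^sup>2 * I))"
  proof -
    have "ennreal x * (ennreal a * ennreal u) + ennreal y * (ennreal b * ennreal v)
        = ennreal (x * (a * u) + y * (b * v))"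
      if "0 \<le> x" "0 \<le> y" "0 \<le> a" "0 \<le> b" "0 \<le> u" "0 \<le> v" for x y a b u v :: real
      using that by (simp add: ennreal_mult)
    then show ?thesis using c I(2) IG(2) by simp
  qed
  finally have "ennreal (pi * R\<^sup>2 * I) \<le> ennreal (c * (pi * R\<^sup>2 * IG) + 1/8 * (pi * (2 * R)\<^sup>2 * I))"
    by (simp only: ennreal_mult''[OF I(2)])
  then have "pi * R\<^sup>2 * I \<le> c * (pi * R\<^sup>2 * IG) + 1/8 * (pi * (2 * R)\<^sup>2 * I)"
    by (rule iffD1[OF ennreal_le_iff, rotated]) (use c I(2) IG(2) in simp)
  \<comment> \<open>The doubled discs contribute \<open>1/8 * 4\<close>, that is half of
    \<open>pi * R\<^sup>2 * I\<close>, which is absorbed on the left. This subtraction is where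
    finiteness of the mass enters.\<close>
  then have "(pi * R\<^sup>2) * I \<le> (pi * R\<^sup>2) * (2 * c * IG)"
    by (simp add: power2_eq_square algebra_simps)
  then have "I \<le> 2 * c * IG" using R by simp
  then show ?thesis
    unfolding I(1) IG(1)[unfolded hG_def] ennreal_mult''[OF IG(2), symmetric] by (rule ennreal_leI)
qed

text \<open>Walk along the segment between the points in equal steps; in the induction,
  \<open>z\<close> is the point one step away from \<open>y\<close>.\<close>

lemma chain_bound:
  fixes F :: "'a::real_normed_vector \<Rightarrow> real"
  assumes step: "\<And>x y. dist x y \<le> d \<Longrightarrow> F x \<le> C * F y" and C: "0 \<le> C"
    and xy: "dist x y \<le> real n * d"
  shows "F x \<le> C ^ n * F y"
  using xy
proof (induction n arbitrary: y)
  case 0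
  then show ?case by simp
next
  case (Suc n)
  define z where "z = x + (real n / real (Suc n)) *\<^sub>R (y - x)"
  have "dist x z = (real n / real (Suc n)) * dist x y"
    by (simp add: z_def dist_norm norm_minus_commute)
  also have "\<dots> \<le> (real n / real (Suc n)) * (real (Suc n) * d)"
    by (intro mult_left_mono Suc.prems) auto
  finally have "dist x z \<le> real n * d" by simp
  then have "F x \<le> C ^ n * F z" by (rule Suc.IH)
  moreover have "dist z y \<le> d"
  proof -
    have "z - y = (1 / real (Suc n)) *\<^sub>R (x - y)"
    proof -
      define t where "t = 1 / real (Suc n)"
      have "real n / real (Suc n) = 1 - t" by (simp add: t_def field_simps)
      then have "z - y = t *\<^sub>R (x - y)" by (simp only: z_def) (simp add: algebra_simps)
      then show ?thesis by (simp only: t_def)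
    qed
    then have "dist z y = dist x y / real (Suc n)" by (simp add: dist_norm)
    then show ?thesis using Suc.prems by (simp add: divide_le_eq mult.commute)
  qed
  then have "C ^ n * F z \<le> C ^ n * (C * F y)" using step C by (intro mult_left_mono) auto
  ultimately show ?case by (simp add: mult_ac)
qed

subsection \<open>The restricted Muckenhoupt condition\<close>

text \<open>Integrability is demanded on compact sets only, so measurability comes from truncation
  to growing discs.\<close>

lemma weight_measurable:
  assumes "weight w"
  shows "w \<in> borel_measurable lebesgue"
proof (rule borel_measurable_LIMSEQ_real)
  fix z
  show "(\<lambda>n. indicator (cball 0 (real n)) z *\<^sub>R w z) \<longlonglongrightarrow> w z"
  proof (rule tendsto_eventually)
    obtain N :: nat where "cmod z \<le> real N" using real_arch_simple by blast
    then show "\<forall>\<^sub>F n in sequentially. indicator (cball 0 (real n)) z *\<^sub>R w z = w z"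
      by (intro eventually_sequentiallyI[of N]) (auto simp: indicator_def)
  qed
next
  show "(\<lambda>z. indicator (cball 0 (real n)) z *\<^sub>R w z) \<in> borel_measurable lebesgue" for n
    using assms compact_cball unfolding weight_def set_integrable_def by blast
qed

lemma wmass_mono: "A \<subseteq> B \<Longrightarrow> wmass w A \<le> wmass w B"
  unfolding wmass_def by (intro nn_integral_mono) (auto simp: indicator_def)

lemma wmass_finite:
  assumes "weight w" "bounded E"
  shows "wmass w E < \<infinity>"
proof -
  obtain \<rho> where "\<forall>z\<in>E. cmod z \<le> \<rho>" using assms(2) unfolding bounded_iff by blast
  then have \<rho>: "E \<subseteq> cball 0 \<rho>" by auto
  have "integrable lebesgue (\<lambda>z. indicator (cball 0 \<rho>) z *\<^sub>R w z)"
    using assms(1) compact_cball[of 0 \<rho>] unfolding weight_def set_integrable_def by blast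
  then have "(\<integral>\<^sup>+z. ennreal (norm (indicator (cball 0 \<rho>) z *\<^sub>R w z)) \<partial>lebesgue) < \<infinity>"
    by (simp add: integrable_iff_bounded)
  moreover have "wmass w (cball 0 \<rho>) = (\<integral>\<^sup>+z. ennreal (norm (indicator (cball 0 \<rho>) z *\<^sub>R w z)) \<partial>lebesgue)"
    unfolding wmass_def
    by (intro nn_integral_cong) (use assms(1) in \<open>auto simp: indicator_def weight_def\<close>)
  ultimately show ?thesis using wmass_mono[OF \<rho>, of w] by (metis le_less_trans)
qed

lemma emeasure_square:
  assumes "0 \<le> r"
  shows "emeasure lebesgue (square a r) = ennreal (r\<^sup>2)"
proof -
  have "emeasure lborel (cbox a (a + Complex r r)) = (\<Prod>b\<in>Basis. (a + Complex r r - a) \<bullet> b)"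
    using assms by (intro emeasure_lborel_cbox) (auto simp: Basis_complex_def inner_complex_def)
  also have "(\<Prod>b\<in>Basis. (a + Complex r r - a) \<bullet> b) = r\<^sup>2"
    by (simp add: Basis_complex_def inner_complex_def power2_eq_square complex_eq_iff)
  finally show ?thesis by (simp add: square_def)
qed

lemma square_sets [measurable]: "square a r \<in> sets lebesgue"
  by (simp add: square_def)

lemma in_square_iff:
  "z \<in> square a r \<longleftrightarrow> Re a \<le> Re z \<and> Re z \<le> Re a + r \<and> Im a \<le> Im z \<and> Im z \<le> Im a + r"
  by (auto simp: square_def in_cbox_complex_iff)

lemma bounded_square: "bounded (square a r)"
  by (simp add: square_def)

text \<open>The common consequence of the conditions for \<open>p > 1\<close> and for
  \<open>p = 1\<close>: a one-scale form of the A-infinity property. The mass stands in place of the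
  average because \<open>r\<close> is fixed.\<close>

definition uniformly_nonvanishing :: "(complex \<Rightarrow> real) \<Rightarrow> real \<Rightarrow> bool" where
  "uniformly_nonvanishing w r \<longleftrightarrow> (\<forall>\<eta>>0. \<exists>c>0. \<forall>a.
     emeasure lebesgue {z \<in> square a r. ennreal (w z) \<le> ennreal c * wmass w (square a r)} \<le> ennreal \<eta>)"

lemma nn_integral_square_eq_avg:
  assumes "0 < r"
  shows "(\<integral>\<^sup>+z\<in>square a r. g z \<partial>lebesgue) = ennreal (r\<^sup>2) * avg (square a r) g"
proof -
  let ?I = "\<integral>\<^sup>+z\<in>square a r. g z \<partial>lebesgue"
  have "ennreal (r\<^sup>2) * (?I / ennreal (r\<^sup>2)) = ?I * ennreal (r\<^sup>2) / ennreal (r\<^sup>2)"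
    by (simp only: ennreal_times_divide mult.commute)
  also have "\<dots> = ?I"
    using assms by (intro mult_divide_eq_ennreal) auto
  finally show ?thesis
    unfolding avg_def emeasure_square[OF less_imp_le[OF assms]] by simp
qed

text \<open>Markov's inequality for the power \<open>-1 / (p - 1)\<close> of \<open>w\<close>: where
  \<open>w\<close> is small, \<open>u\<close> is at least \<open>1 / k\<close>, and
  \<open>W * V powr (p - 1) \<le> T\<close> controls the integral of \<open>u\<close> in terms of
  the mass of \<open>w\<close>.\<close>

lemma Ap_restricted_uniformly_nonvanishing:
  assumes p: "1 < p" and w: "w \<in> Ap_restricted p"
  shows "\<exists>r>0. uniformly_nonvanishing w r"
proof -
  have weight: "weight w" using w by (simp add: Ap_restricted_def)
  define s where "s = conj_exp p / p"
  have s: "s = 1 / (p - 1)" and ps: "p / conj_exp p = p - 1"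
    using p by (auto simp: s_def conj_exp_def)
  define u where "u = (\<lambda>z. inverse (ennreal (w z powr s)))"
  have u[measurable]: "u \<in> borel_measurable lebesgue"
    using weight_measurable[OF weight] unfolding u_def by measurable
  obtain r T where r: "0 < r" and T: "0 \<le> T"
    and bound: "\<And>a. mult_infty (avg (square a r) (\<lambda>z. ennreal (w z)))
      (epowr (avg (square a r) u) (p - 1)) \<le> ennreal T"
  proof -
    obtain r where r: "0 < r" and fin: "(SUP a. mult_infty (avg (square a r) (\<lambda>z. ennreal (w z)))
      (epowr (avg (square a r) u) (p - 1))) < \<infinity>" (is "(SUP a. ?f a) < _")
      using w unfolding Ap_restricted_def s_def[symmetric] u_def ps by auto
    have "?f a \<le> ennreal (enn2real (SUP a. ?f a))" for a
      using fin by (auto intro: SUP_upper)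
    then show thesis using that[OF r enn2real_nonneg] by blast
  qed
  have "\<exists>c>0. \<forall>a. emeasure lebesgue {z \<in> square a r. ennreal (w z) \<le> ennreal c * wmass w (square a r)}
      \<le> ennreal \<eta>" if \<eta>: "0 < \<eta>" for \<eta>
  proof -
    \<comment> \<open>Chosen so that \<open>c * (r\<^sup>2 * W) \<le> (\<eta> / (r\<^sup>2 * V))
      powr (p - 1)\<close> whenever \<open>V\<close> is positive and
      \<open>W * V powr (p - 1) \<le> T\<close>; \<open>T + 1\<close> keeps the denominator
      positive.\<close>
    define c where "c = (\<eta> / r\<^sup>2) powr (p - 1) / (r\<^sup>2 * (T + 1))"
    have c: "0 < c" using r T \<eta> by (simp add: c_def)
    show ?thesis
    proof (intro exI conjI allI, rule c)
      fix a
      let ?Q = "square a r"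
      let ?W = "avg ?Q (\<lambda>z. ennreal (w z))" and ?V = "avg ?Q u"
      \<comment> \<open>By the convention built into \<open>mult_infty\<close>, a finite supremum
        forces both factors to be finite.\<close>
      have fin: "?W \<noteq> \<infinity>" "?V \<noteq> \<infinity>" and prod: "?W * epowr ?V (p - 1) \<le> ennreal T"
        using bound[of a] by (auto simp: mult_infty_def epowr_def top_unique split: if_splits)
      define W where "W = enn2real ?W"
      define V where "V = enn2real ?V"
      have W: "?W = ennreal W" "0 \<le> W" and V: "?V = ennreal V" "0 \<le> V"
        using fin by (auto simp: W_def V_def less_top)
      have WV: "W * V powr (p - 1) \<le> T"
        using prod W V T by (simp add: epowr_def flip: ennreal_mult')
      have mass: "wmass w ?Q = ennreal (r\<^sup>2 * W)"
        unfolding wmass_def nn_integral_square_eq_avg[OF r] W(1) using W(2) by (simp add: ennreal_mult')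
      have int_u: "(\<integral>\<^sup>+z. u z * indicator ?Q z \<partial>lebesgue) = ennreal (r\<^sup>2 * V)"
      proof -
        show ?thesis
          unfolding nn_integral_square_eq_avg[OF r] V(1) using V(2) by (simp add: ennreal_mult')
      qed
      \<comment> \<open>The Markov threshold: the second condition bounds the measure by
        \<open>\<eta>\<close>, the third makes \<open>w z \<le> c * (r\<^sup>2 * W)\<close> imply
        \<open>w z powr s \<le> k\<close>. For \<open>V = 0\<close> the second holds for every
        \<open>k\<close>, so \<open>k\<close> is simply taken large.\<close>
      obtain k where k: "0 < k" "k * (r\<^sup>2 * V) \<le> \<eta>" "c * (r\<^sup>2 * W) \<le> k powr (p - 1)"
      proof (cases "V = 0")
        case True
        define k where "k = (c * (r\<^sup>2 * W) + 1) powr (1 / (p - 1))"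
        have pos: "0 < c * (r\<^sup>2 * W) + 1" using c W by (simp add: add_nonneg_pos)
        then have "k powr (p - 1) = c * (r\<^sup>2 * W) + 1" using p by (simp add: k_def powr_powr)
        moreover have "0 < k" using pos by (simp add: k_def)
        ultimately show thesis using that[of k] True \<eta> by simp
      next
        case False
        define k where "k = \<eta> / (r\<^sup>2 * V)"
        have Vpos: "0 < V" using False V by simp
        have "c * (r\<^sup>2 * W) = (\<eta> / r\<^sup>2) powr (p - 1) * (W / (T + 1))"
          using r T by (simp add: c_def)
        also have "\<dots> \<le> (\<eta> / r\<^sup>2) powr (p - 1) * (1 / V powr (p - 1))"
        proof (intro mult_left_mono)
          show "W / (T + 1) \<le> 1 / V powr (p - 1)"
            using WV T Vpos by (simp add: field_simps)
        qed simp
        also have "\<dots> = k powr (p - 1)"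
          using \<eta> r Vpos by (simp add: k_def powr_divide powr_mult)
        finally show thesis using that[of k] \<eta> r Vpos by (simp add: k_def)
      qed
      have "{z \<in> ?Q. ennreal (w z) \<le> ennreal c * wmass w ?Q} \<subseteq> {z \<in> ?Q. 1 \<le> ennreal k * u z}"
      proof clarify
        fix z assume z: "z \<in> ?Q" "ennreal (w z) \<le> ennreal c * wmass w ?Q"
        have w0: "0 \<le> w z" using weight by (simp add: weight_def)
        have "w z \<le> c * (r\<^sup>2 * W)"
          using z(2) c W unfolding mass by (simp flip: ennreal_mult')
        then have "w z \<le> k powr (p - 1)" using k(3) by linarith
        then have "w z powr s \<le> (k powr (p - 1)) powr s"
          using w0 p by (intro powr_mono2) (auto simp: s)
        also have "\<dots> = k" using p k(1) by (simp add: powr_powr s)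
        finally have le: "w z powr s \<le> k" .
        show "1 \<le> ennreal k * u z"
        \<comment> \<open>Zeros of \<open>w\<close> belong to the Markov set too, because
          \<open>u\<close> is infinite there.\<close>
        proof (cases "w z = 0")
          case True
          then show ?thesis using k(1) by (simp add: u_def ennreal_mult_top)
        next
          case False
          then have pos: "0 < w z powr s" using w0 by simp
          then have "u z = ennreal (inverse (w z powr s))"
            unfolding u_def by (rule inverse_ennreal)
          moreover have "1 \<le> k * inverse (w z powr s)" using le pos by (simp add: field_simps)
          ultimately show ?thesis using k(1) by (simp flip: ennreal_mult')
        qed
      qed
      then have "emeasure lebesgue {z \<in> ?Q. ennreal (w z) \<le> ennreal c * wmass w ?Q}
          \<le> emeasure lebesgue {z \<in> ?Q. 1 \<le> ennreal k * u z}"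
      proof (rule emeasure_mono)
        have "{z \<in> space lebesgue. z \<in> ?Q \<and> 1 \<le> ennreal k * u z} \<in> sets lebesgue"
          by measurable
        then show "{z \<in> ?Q. 1 \<le> ennreal k * u z} \<in> sets lebesgue" by simp
      qed
      also have "\<dots> \<le> ennreal k * (\<integral>\<^sup>+z. u z * indicator ?Q z \<partial>lebesgue)"
        by (rule nn_integral_Markov_inequality) measurable
      also have "\<dots> \<le> ennreal \<eta>"
        using k V r unfolding int_u by (simp add: ennreal_leI flip: ennreal_mult')
      finally show "emeasure lebesgue {z \<in> ?Q. ennreal (w z) \<le> ennreal c * wmass w ?Q} \<le> ennreal \<eta>" .
    qed
  qed
  then show ?thesis using r unfolding uniformly_nonvanishing_def by blast
qed

text \<open>Here the exceptional set is null: almost everywhere \<open>1 \<le> V * w z\<close>,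
  whereas \<open>w z \<le> c * (r\<^sup>2 * W) = W / (T + 1)\<close> would give
  \<open>V * w z < 1\<close>.\<close>

lemma A1_restricted_uniformly_nonvanishing:
  assumes w: "w \<in> A1_restricted"
  shows "\<exists>r>0. uniformly_nonvanishing w r"
proof -
  have weight: "weight w" using w by (simp add: A1_restricted_def)
  define v where "v = (\<lambda>a r. esssup (restrict_space lebesgue (square a r)) (\<lambda>z. inverse (ennreal (w z))))"
  obtain r T where r: "0 < r" and T: "0 \<le> T"
    and bound: "\<And>a. mult_infty (avg (square a r) (\<lambda>z. ennreal (w z))) (v a r) \<le> ennreal T"
  proof -
    obtain r where r: "0 < r" and fin: "(SUP a. mult_infty (avg (square a r) (\<lambda>z. ennreal (w z)))
      (v a r)) < \<infinity>" (is "(SUP a. ?f a) < _")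
      using w unfolding A1_restricted_def v_def by auto
    have "?f a \<le> ennreal (enn2real (SUP a. ?f a))" for a
      using fin by (auto intro: SUP_upper)
    then show thesis using that[OF r enn2real_nonneg] by blast
  qed
  define c where "c = 1 / (r\<^sup>2 * (T + 1))"
  have c: "0 < c" using r T by (simp add: c_def)
  have "emeasure lebesgue {z \<in> square a r. ennreal (w z) \<le> ennreal c * wmass w (square a r)} = 0" for a
  proof -
    let ?Q = "square a r"
    let ?W = "avg ?Q (\<lambda>z. ennreal (w z))" and ?V = "v a r"
    have fin: "?W \<noteq> \<infinity>" "?V \<noteq> \<infinity>" and prod: "?W * ?V \<le> ennreal T"
      using bound[of a] by (auto simp: mult_infty_def top_unique split: if_splits)
    define W where "W = enn2real ?W"
    define V where "V = enn2real ?V"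
    have W: "?W = ennreal W" "0 \<le> W" and V: "?V = ennreal V" "0 \<le> V"
      using fin by (auto simp: W_def V_def less_top)
    have WV: "W * V \<le> T"
      using prod W V T by (simp flip: ennreal_mult')
    have mass: "wmass w ?Q = ennreal (r\<^sup>2 * W)"
      unfolding wmass_def nn_integral_square_eq_avg[OF r] W(1) using W(2) by (simp add: ennreal_mult')
    have "AE z in restrict_space lebesgue ?Q. inverse (ennreal (w z)) \<le> ?V"
      unfolding v_def by (rule esssup_AE)
    then have "AE z in lebesgue. z \<in> ?Q \<longrightarrow> inverse (ennreal (w z)) \<le> ?V"
      by (subst (asm) AE_restrict_space_iff) auto
    then have "AE z in lebesgue. \<not> (z \<in> ?Q \<and> ennreal (w z) \<le> ennreal c * wmass w ?Q)"
    proof eventually_elim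
      case (elim z)
      show ?case
      proof
        assume z: "z \<in> ?Q \<and> ennreal (w z) \<le> ennreal c * wmass w ?Q"
        have w0: "0 \<le> w z" using weight by (simp add: weight_def)
        have inv: "inverse (ennreal (w z)) \<le> ennreal V" using elim z V by simp
        then have pos: "0 < w z" using w0 by (cases "w z = 0") (auto simp: top_unique)
        have "inverse (w z) \<le> V"
          using inv V pos by (simp add: inverse_ennreal)
        then have "1 \<le> V * w z" using pos by (simp add: field_simps)
        also have "w z \<le> c * (r\<^sup>2 * W)"
          using z c W unfolding mass by (simp flip: ennreal_mult')
        then have "V * w z \<le> V * (W / (T + 1))"
          using V r by (intro mult_left_mono) (auto simp: c_def)
        also have "\<dots> < 1" using WV T by (simp add: field_simps)
        finally show False by simp
      qed
    qed
    then have "emeasure lebesgue {z \<in> space lebesgue. z \<in> ?Q \<and> ennreal (w z) \<le> ennreal c * wmass w ?Q} = 0"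
      by (rule emeasure_eq_0_AE)
    then show ?thesis by simp
  qed
  then have "uniformly_nonvanishing w r" unfolding uniformly_nonvanishing_def using c by auto
  then show ?thesis using r by blast
qed

text \<open>Removing the exceptional set \<open>L\<close> for \<open>\<eta> / 2\<close> leaves a
  part of \<open>E\<close> of measure at least \<open>\<eta> / 2\<close> on which \<open>w\<close>
  exceeds a fixed multiple of the mass of the square.\<close>

lemma uniformly_nonvanishing_subset_mass:
  assumes w: "weight w" and nv: "uniformly_nonvanishing w r" and \<eta>: "0 < \<eta>"
  shows "\<exists>c>0. \<forall>a E. E \<in> sets lebesgue \<and> E \<subseteq> square a r \<and> ennreal \<eta> \<le> emeasure lebesgue E
    \<longrightarrow> ennreal c * wmass w (square a r) \<le> wmass w E \<and> 0 < wmass w E"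
proof -
  have half: "0 < \<eta> / 2" using \<eta> by simp
  obtain c where c: "0 < c" and small: "\<And>a. emeasure lebesgue
      {z \<in> square a r. ennreal (w z) \<le> ennreal c * wmass w (square a r)} \<le> ennreal (\<eta> / 2)"
    using nv half unfolding uniformly_nonvanishing_def by blast
  have meas[measurable]: "w \<in> borel_measurable lebesgue" using w by (rule weight_measurable)
  show ?thesis
  proof (intro exI allI impI, rule conjI, safe)
    show "0 < c * (\<eta> / 2)" using c \<eta> by simp
    fix a E assume E: "E \<in> sets lebesgue" "E \<subseteq> square a r" "ennreal \<eta> \<le> emeasure lebesgue E"
    define m where "m = ennreal c * wmass w (square a r)"
    define L where "L = {z \<in> square a r. ennreal (w z) \<le> m}"
    have "{z \<in> space lebesgue. z \<in> square a r \<and> ennreal (w z) \<le> m} \<in> sets lebesgue" by measurable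
    then have L: "L \<in> sets lebesgue" by (simp add: L_def)
    have "ennreal (2 * (\<eta> / 2)) \<le> emeasure lebesgue E" using E(3) by simp
    then have big: "ennreal (\<eta> / 2) \<le> emeasure lebesgue (E - L)"
      using small[of a] half by (intro emeasure_Diff_ge_half[OF E(1) L]) (auto simp: L_def m_def)
    have gt: "m < ennreal (w z)" if "z \<in> E - L" for z
      using that E(2) by (auto simp: L_def)
    have "ennreal (c * (\<eta> / 2)) * wmass w (square a r) = m * ennreal (\<eta> / 2)"
      using c by (simp only: m_def ennreal_mult'[OF less_imp_le[OF c]] mult_ac)
    also have "\<dots> \<le> m * emeasure lebesgue (E - L)" using big by (intro mult_left_mono) auto
    also have "\<dots> = (\<integral>\<^sup>+z. m * indicator (E - L) z \<partial>lebesgue)"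
      using E L by (intro nn_integral_cmult_indicator[symmetric]) auto
    also have "\<dots> \<le> wmass w E"
      unfolding wmass_def using gt
      by (intro nn_integral_mono) (auto simp: indicator_def less_imp_le)
    finally show "ennreal (c * (\<eta> / 2)) * wmass w (square a r) \<le> wmass w E" .
    \<comment> \<open>The lower bound alone would not exclude a square of mass 0; the strict
      inequality \<open>m < w z\<close> on \<open>E - L\<close> does.\<close>
    show "0 < wmass w E"
    proof (rule ccontr)
      assume "\<not> 0 < wmass w E"
      then have "(\<integral>\<^sup>+z. ennreal (w z) * indicator E z \<partial>lebesgue) = 0"
        by (simp add: wmass_def zero_less_iff_neq_zero)
      then have "AE z in lebesgue. ennreal (w z) * indicator E z = 0"
        using E(1) by (subst (asm) nn_integral_0_iff_AE) auto
      then have "AE z in lebesgue. z \<notin> E - L"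
      proof eventually_elim
        case (elim z)
        show ?case
        proof
          assume z: "z \<in> E - L"
          then have "ennreal (w z) = 0" using elim by simp
          then show False using gt[OF z] by (simp only: not_less_zero)
        qed
      qed
      then have "emeasure lebesgue (E - L) = 0"
        using E(1) L by (subst AE_iff_measurable[symmetric, where P = "\<lambda>z. z \<notin> E - L"]) auto
      then show False using big half by simp
    qed
  qed
qed

section \<open>Comparability of the averaged weight\<close>

lemma what_eq: "what w z = enn2real (wmass w (ball z 1)) / pi"
  using emeasure_lebesgue_ball_complex[of 1 z] by (simp add: what_def measure_def)

lemma Ainf_restricted_weight: "w \<in> Ainf_restricted \<Longrightarrow> weight w"
  by (auto simp: Ainf_restricted_def A1_restricted_def Ap_restricted_def)

lemma Ainf_restricted_uniformly_nonvanishing: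
  "w \<in> Ainf_restricted \<Longrightarrow> \<exists>r>0. uniformly_nonvanishing w r"
  using Ap_restricted_uniformly_nonvanishing A1_restricted_uniformly_nonvanishing
  by (auto simp: Ainf_restricted_def)

lemma norm_Complex_same: "0 \<le> s \<Longrightarrow> cmod (Complex s s) \<le> 2 * s"
  using cmod_le[of "Complex s s"] by simp

text \<open>Squares of side \<open>r\<close> are compared first, through a subsquare common to two
  neighbours that carries a fixed share of both masses. The mass of a unit disc is then bounded
  below by a small square inside it and above by a fixed number of squares covering it.\<close>

lemma what_comparable:
  assumes "w \<in> Ainf_restricted"
  shows "\<exists>C\<ge>1. (\<forall>z. 0 < what w z) \<and> (\<forall>z u n. dist z u \<le> real n \<longrightarrow> what w z \<le> C ^ n * what w u)"
proof -
  have w: "weight w" by (rule Ainf_restricted_weight[OF assms])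
  obtain r where r: "0 < r" and nv: "uniformly_nonvanishing w r"
    using Ainf_restricted_uniformly_nonvanishing[OF assms] by blast
  define m where "m = (\<lambda>a. enn2real (wmass w (square a r)))"
  have m: "wmass w (square a r) = ennreal (m a)" "0 \<le> m a" for a
    using wmass_finite[OF w bounded_square, of a r] by (auto simp: m_def)
  define b where "b = (\<lambda>a. enn2real (wmass w (ball a 1)))"
  have b: "wmass w (ball a 1) = ennreal (b a)" "0 \<le> b a" for a
    using wmass_finite[OF w bounded_ball, of a 1] by (auto simp: b_def)
  have "0 < (r / 2)\<^sup>2" using r by simp
  from uniformly_nonvanishing_subset_mass[OF w nv this] obtain c where c: "0 < c"
    and sub: "\<And>a E. E \<in> sets lebesgue \<Longrightarrow> E \<subseteq> square a r \<Longrightarrow> ennreal ((r / 2)\<^sup>2) \<le> emeasure lebesgue E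
      \<Longrightarrow> ennreal c * wmass w (square a r) \<le> wmass w E"
    by blast
  have step: "m x \<le> (1 / c) * m y" if "dist x y \<le> r / 2" for x y
  proof -
    \<comment> \<open>Squares are indexed by their lower left corner, so the componentwise maximum
      of two corners is the corner of the intersection.\<close>
    define q where "q = Complex (max (Re x) (Re y)) (max (Im x) (Im y))"
    have "Re x - Re y \<le> r / 2" "Re y - Re x \<le> r / 2" "Im x - Im y \<le> r / 2" "Im y - Im x \<le> r / 2"
      using that abs_Re_le_cmod[of "x - y"] abs_Im_le_cmod[of "x - y"]
      unfolding dist_norm abs_le_iff minus_complex.simps by linarith+
    then have qx: "square q (r / 2) \<subseteq> square x r" and qy: "square q (r / 2) \<subseteq> square y r"
      by (auto simp: in_square_iff q_def max_def)
    have "ennreal c * ennreal (m x) \<le> wmass w (square q (r / 2))"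
      using sub[OF square_sets qx] r by (simp only: emeasure_square m)
    also have "\<dots> \<le> ennreal (m y)"
      using wmass_mono[OF qy, of w] by (simp only: m)
    finally have "c * m x \<le> m y"
      using c m by (simp flip: ennreal_mult')
    then show ?thesis using c by (simp add: field_simps)
  qed
  \<comment> \<open>Both coordinates differ by at most \<open>1/3\<close> in such a square, so its
    points are at distance at most \<open>2/3\<close> from the corner.\<close>
  define \<rho> where "\<rho> = min r (1 / 3)"
  have \<rho>: "0 < \<rho>" using r by (simp add: \<rho>_def)
  then have "0 < \<rho>\<^sup>2" by simp
  from uniformly_nonvanishing_subset_mass[OF w nv this] obtain c' where c': "0 < c'"
    and sub': "\<And>a E. E \<in> sets lebesgue \<Longrightarrow> E \<subseteq> square a r \<Longrightarrow> ennreal (\<rho>\<^sup>2) \<le> emeasure lebesgue E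
      \<Longrightarrow> ennreal c' * wmass w (square a r) \<le> wmass w E \<and> 0 < wmass w E"
    by blast
  have small_square: "square u \<rho> \<subseteq> ball u 1" for u
  proof
    fix z assume "z \<in> square u \<rho>"
    then have "\<bar>Re (z - u)\<bar> \<le> 1/3" "\<bar>Im (z - u)\<bar> \<le> 1/3"
      by (auto simp: in_square_iff \<rho>_def)
    then show "z \<in> ball u 1" using cmod_le[of "z - u"] by (simp add: dist_norm norm_minus_commute)
  qed
  have sq_sub: "square u \<rho> \<subseteq> square u r" for u
    by (auto simp: in_square_iff \<rho>_def)
  have lower: "c' * m u \<le> b u" and pos: "0 < b u" for u
  proof -
    have h: "ennreal c' * ennreal (m u) \<le> wmass w (square u \<rho>)" "0 < wmass w (square u \<rho>)"
      using sub'[OF square_sets sq_sub[of u]] \<rho> by (simp_all only: emeasure_square m)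
    have le: "wmass w (square u \<rho>) \<le> ennreal (b u)"
      using wmass_mono[OF small_square[of u], of w] by (simp only: b)
    have "ennreal (c' * m u) \<le> ennreal (b u)"
      using order_trans[OF h(1) le] by (simp only: ennreal_mult'[OF less_imp_le[OF c']])
    then show "c' * m u \<le> b u" by (simp only: ennreal_le_iff[OF b(2)])
    show "0 < b u" using less_le_trans[OF h(2) le] by simp
  qed
  \<comment> \<open>One finite cover of the unit disc at the origin, translated to each
    \<open>z\<close>, makes the number of squares independent of \<open>z\<close>.\<close>
  obtain X where X: "finite X" "X \<subseteq> cball 0 1" "cball (0::complex) 1 \<subseteq> (\<Union>x\<in>X. ball x (r / 2))"
  proof (rule compactE_image[OF compact_cball])
    show "cball (0::complex) 1 \<subseteq> (\<Union>x\<in>cball 0 1. ball x (r / 2))"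
      using r by auto
  qed auto
  \<comment> \<open>The corner \<open>z + x - t\<close> centres the square of side \<open>r\<close>
    at \<open>z + x\<close>.\<close>
  define t where "t = Complex (r / 2) (r / 2)"
  have t: "cmod t \<le> r" using norm_Complex_same[of "r / 2"] r by (simp add: t_def)
  \<comment> \<open>The corner \<open>z + x - t\<close> is at distance at most
    \<open>1 + 1 + r\<close> from \<open>u\<close>; \<open>N\<close> counts the steps of length
    \<open>r / 2\<close>.\<close>
  obtain N :: nat where N: "2 + r \<le> real N * (r / 2)"
    using reals_Archimedean3[of "r / 2"] r by (metis half_gt_zero less_imp_le)
  have upper: "b z \<le> (real (card X) * (1 / c) ^ N) * m u" if zu: "dist z u \<le> 1" for z u
  proof -
    have cover: "ball z 1 \<subseteq> (\<Union>x\<in>X. square (z + x - t) r)"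
    proof
      fix y assume "y \<in> ball z 1"
      then have "y - z \<in> cball 0 1" by (simp add: dist_norm norm_minus_commute less_imp_le)
      then obtain x where x: "x \<in> X" "dist x (y - z) < r / 2" using X(3) by auto
      have "Re x - (Re y - Re z) < r / 2" "Re y - Re z - Re x < r / 2"
        "Im x - (Im y - Im z) < r / 2" "Im y - Im z - Im x < r / 2"
        using x(2) abs_Re_le_cmod[of "x - (y - z)"] abs_Im_le_cmod[of "x - (y - z)"]
        unfolding dist_norm abs_le_iff minus_complex.simps by linarith+
      then have "y \<in> square (z + x - t) r" by (auto simp: in_square_iff t_def)
      then show "y \<in> (\<Union>x\<in>X. square (z + x - t) r)" using x(1) by blast
    qed
    have each: "m (z + x - t) \<le> (1 / c) ^ N * m u" if "x \<in> X" for x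
    proof (rule chain_bound[OF step])
      have eq: "z + x - t - u = (z - u) + x - t" by simp
      have "dist (z + x - t) u \<le> cmod (z - u) + cmod x + cmod t"
        unfolding dist_norm eq
        using norm_triangle_ineq4[of "(z - u) + x" t] norm_triangle_ineq[of "z - u" x] by linarith
      then show "dist (z + x - t) u \<le> real N * (r / 2)"
        using zu t N X(2) that by (auto simp: dist_norm)
    qed (use c in auto)
    have "ennreal (b z) \<le> wmass w (\<Union>x\<in>X. square (z + x - t) r)"
      using wmass_mono[OF cover, of w] unfolding b .
    also have "\<dots> \<le> (\<Sum>x\<in>X. wmass w (square (z + x - t) r))"
    proof -
      have "wmass w (\<Union>x\<in>X. square (z + x - t) r)
          \<le> (\<integral>\<^sup>+y. (\<Sum>x\<in>X. ennreal (w y) * indicator (square (z + x - t) r) y) \<partial>lebesgue)"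
        unfolding wmass_def
      proof (rule nn_integral_mono)
        fix y
        show "ennreal (w y) * indicator (\<Union>x\<in>X. square (z + x - t) r) y
          \<le> (\<Sum>x\<in>X. ennreal (w y) * indicator (square (z + x - t) r) y)"
        proof (cases "y \<in> (\<Union>x\<in>X. square (z + x - t) r)")
          case True
          then obtain x where x: "x \<in> X" "y \<in> square (z + x - t) r" by blast
          have "ennreal (w y) = ennreal (w y) * indicator (square (z + x - t) r) y" using x by simp
          also have "\<dots> \<le> (\<Sum>x\<in>X. ennreal (w y) * indicator (square (z + x - t) r) y)"
            by (rule member_le_sum) (use x X(1) in auto)
          finally show ?thesis using True by simp
        qed simp
      qed
      also have "\<dots> = (\<Sum>x\<in>X. wmass w (square (z + x - t) r))"
        unfolding wmass_def using weight_measurable[OF w]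
        by (intro nn_integral_sum borel_measurable_times_ennreal measurable_compose[OF _ measurable_ennreal])
          (auto intro: borel_measurable_indicator square_sets)
      finally show ?thesis .
    qed
    also have "\<dots> = ennreal (\<Sum>x\<in>X. m (z + x - t))"
      using m by (simp add: sum_ennreal)
    also have "\<dots> \<le> ennreal (real (card X) * ((1 / c) ^ N * m u))"
      using sum_bounded_above[of X "\<lambda>x. m (z + x - t)", OF each] by (intro ennreal_leI) simp
    finally show ?thesis
      using m(2)[of u] c by (simp add: mult.assoc)
  qed
  define C where "C = max 1 (real (card X) * (1 / c) ^ N / c')"
  have C: "1 \<le> C" by (simp add: C_def)
  have one: "b z \<le> C * b u" if "dist z u \<le> 1" for z u
  proof -
    have "b z \<le> (real (card X) * (1 / c) ^ N) * m u" by (rule upper[OF that])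
    also have "\<dots> \<le> (real (card X) * (1 / c) ^ N) * (b u / c')"
      using lower[of u] c c' by (intro mult_left_mono) (auto simp: field_simps)
    also have "\<dots> = (real (card X) * (1 / c) ^ N / c') * b u" by simp
    also have "\<dots> \<le> C * b u" using b by (intro mult_right_mono) (auto simp: C_def)
    finally show ?thesis .
  qed
  have "what w z \<le> C ^ n * what w u" if "dist z u \<le> real n" for z u n
    using chain_bound[of 1 b C z u n, OF one] that C
    by (simp add: what_eq b_def divide_right_mono)
  moreover have "0 < what w z" for z using pos[of z] by (simp add: what_eq b_def)
  ultimately show ?thesis using C by blast
qed

subsection \<open>Relatively dense sets dominate\<close>

lemma what_measurable:
  assumes "weight w"
  shows "what w \<in> borel_measurable lebesgue"
proof -
  have "(\<lambda>a. wmass w (ball a 1)) \<in> borel_measurable borel"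
    unfolding wmass_def
    by (intro measurable_ball_average measurable_compose[OF weight_measurable[OF assms] measurable_ennreal]) simp
  then have "what w \<in> borel_measurable borel"
    unfolding what_eq[abs_def] by measurable
  then show ?thesis by (intro measurable_completion) simp
qed

lemma nn_integral_ratio_bound:
  fixes g h :: "complex \<Rightarrow> real"
  assumes A[measurable]: "A \<in> sets lebesgue" and g[measurable]: "g \<in> borel_measurable lebesgue" and k: "0 \<le> k"
    and le: "\<And>u. u \<in> A \<Longrightarrow> h u \<le> k * g u"
  shows "(\<integral>\<^sup>+u\<in>A. ennreal (h u) \<partial>lebesgue) \<le> ennreal k * (\<integral>\<^sup>+u\<in>A. ennreal (g u) \<partial>lebesgue)"
proof -
  have "(\<integral>\<^sup>+u\<in>A. ennreal (h u) \<partial>lebesgue) \<le> (\<integral>\<^sup>+u. ennreal k * (ennreal (g u) * indicator A u) \<partial>lebesgue)"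
    using le k by (intro nn_integral_mono)
      (auto simp: indicator_def ennreal_mult'[symmetric] intro!: ennreal_leI)
  also have "\<dots> = ennreal k * (\<integral>\<^sup>+u\<in>A. ennreal (g u) \<partial>lebesgue)"
    by (intro nn_integral_cmult) measurable
  finally show ?thesis .
qed

text \<open>The exponential is holomorphic in \<open>u\<close>, so multiplying an entire function by
  it keeps it entire while the Gaussian is recentred at \<open>a\<close>.\<close>

lemma gaussian_translation:
  fixes a u :: complex and \<alpha> p :: real
  shows "cmod (exp (- (of_real \<alpha> * cnj a * (u - a)))) powr p * exp (- (p * \<alpha> / 2) * (cmod a)\<^sup>2)
      * exp (- (p * \<alpha> / 2) * (cmod (u - a))\<^sup>2) = exp (- (p * \<alpha> / 2) * (cmod u)\<^sup>2)"
proof -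
  have sq: "(cmod u)\<^sup>2 = (cmod a)\<^sup>2 + 2 * Re (cnj a * (u - a)) + (cmod (u - a))\<^sup>2"
    by (simp add: cmod_power2) (simp add: power2_eq_square algebra_simps)
  have re: "Re (- (of_real \<alpha> * cnj a * (u - a))) = - (\<alpha> * Re (cnj a * (u - a)))"
    by (simp add: algebra_simps)
  have "cmod (exp (- (of_real \<alpha> * cnj a * (u - a)))) powr p = exp (p * Re (- (of_real \<alpha> * cnj a * (u - a))))"
    by (simp add: norm_exp_eq_Re powr_def del: uminus_complex.simps)
  then show ?thesis
    unfolding re sq mult_exp_exp by (simp only:) (simp add: mult_exp_exp field_simps)
qed

text \<open>On \<open>ball a (2 * R)\<close> the density \<open>h\<close> lies between
  \<open>b * k * |g|^p\<close> and \<open>B * k * |g|^p\<close>, where \<open>g\<close> is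
  \<open>f\<close> times the recentring exponential. The doubling hypothesis for \<open>h\<close>
  thus passes to \<open>|g|^p\<close>, the local estimate passes back, and \<open>k\<close>, the
  only constant depending on \<open>a\<close>, cancels.\<close>

lemma relatively_dense_imp_dominating:
  fixes v :: "complex \<Rightarrow> real"
  assumes p: "0 < p" and \<alpha>: "0 < \<alpha>" and v[measurable]: "v \<in> borel_measurable lebesgue"
    and v_pos: "\<And>z. 0 < v z" and C: "1 \<le> C"
    and v_comp: "\<And>z u n. dist z u \<le> real n \<Longrightarrow> v z \<le> C ^ n * v u"
    and G[measurable]: "G \<in> sets lebesgue" and R: "0 < R" and \<delta>: "0 < \<delta>"
    and dense: "\<And>a. wmass v (G \<inter> ball a R) \<ge> ennreal \<delta> * wmass v (ball a R)"
  shows "dominating p \<alpha> v G"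
proof -
  obtain N :: nat where N: "2 * R \<le> real N" using real_arch_simple by blast
  define B where "B = C ^ N"
  have B: "0 < B" using C by (simp add: B_def)
  have up: "v z \<le> B * v a" and dn: "v a \<le> B * v z" if "z \<in> ball a (2 * R)" for z a
    using that N v_comp[of z a N] v_comp[of a z N] by (auto simp: B_def dist_commute)
  \<comment> \<open>One factor \<open>B\<close> is lost in comparing \<open>v\<close> with
    \<open>v a\<close> on the whole disc, the other on its part in \<open>G\<close>.\<close>
  define \<eta> where "\<eta> = \<delta> * (pi * R\<^sup>2) / B\<^sup>2"
  have \<eta>: "0 < \<eta>" using \<delta> R B by (simp add: \<eta>_def)
  have sub: "ball a R \<subseteq> ball a (2 * R)" for a :: complex using R by auto
  have thick: "ennreal \<eta> \<le> emeasure lebesgue (G \<inter> ball a R)" for a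
  proof -
    have va: "0 < v a" by (rule v_pos)
    have fin: "emeasure lebesgue (G \<inter> ball a R) \<le> ennreal (pi * R\<^sup>2)"
      using emeasure_mono[of "G \<inter> ball a R" "ball a R" lebesgue] emeasure_lebesgue_ball_complex[of R a] R
      by simp
    define e where "e = enn2real (emeasure lebesgue (G \<inter> ball a R))"
    have e: "emeasure lebesgue (G \<inter> ball a R) = ennreal e" "0 \<le> e"
      using le_less_trans[OF fin ennreal_less_top] by (simp_all add: e_def)
    have vB: "0 \<le> v a / B" using va B by simp
    have "ennreal (v a / B * (pi * R\<^sup>2)) = ennreal (v a / B) * emeasure lebesgue (ball a R)"
      by (simp only: emeasure_lebesgue_ball_complex[OF less_imp_le[OF R]] ennreal_mult'[OF vB])
    also have "\<dots> = (\<integral>\<^sup>+z. ennreal (v a / B) * indicator (ball a R) z \<partial>lebesgue)"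
      by (rule nn_integral_cmult_indicator[symmetric]) simp
    also have "\<dots> \<le> wmass v (ball a R)"
      unfolding wmass_def
    proof (rule nn_integral_mono)
      fix z
      show "ennreal (v a / B) * indicator (ball a R) z \<le> ennreal (v z) * indicator (ball a R) z"
        using dn[of z a] sub[of a] B by (auto simp: indicator_def field_simps intro!: ennreal_leI)
    qed
    finally have "ennreal \<delta> * ennreal (v a / B * (pi * R\<^sup>2)) \<le> ennreal \<delta> * wmass v (ball a R)"
      by (intro mult_left_mono) auto
    also have "\<dots> \<le> wmass v (G \<inter> ball a R)" by (rule dense)
    also have "\<dots> \<le> (\<integral>\<^sup>+z. ennreal (B * v a) * indicator (G \<inter> ball a R) z \<partial>lebesgue)"
      unfolding wmass_def
    proof (rule nn_integral_mono)
      fix z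
      show "ennreal (v z) * indicator (G \<inter> ball a R) z \<le> ennreal (B * v a) * indicator (G \<inter> ball a R) z"
        using up[of z a] sub[of a] by (auto simp: indicator_def intro!: ennreal_leI)
    qed
    also have "\<dots> = ennreal (B * v a) * ennreal e"
      unfolding e(1)[symmetric] using G by (intro nn_integral_cmult_indicator) auto
    finally have "\<delta> * (v a / B * (pi * R\<^sup>2)) \<le> B * v a * e"
      using e(2) B va \<delta> by (simp flip: ennreal_mult')
    then have "v a * \<eta> \<le> v a * e" using B by (simp add: \<eta>_def field_simps power2_eq_square)
    then have "\<eta> \<le> e" using va by simp
    then show ?thesis unfolding e(1) by (rule ennreal_leI)
  qed
  \<comment> \<open>Worst case on \<open>ball a (2 * R)\<close>: the Gaussian at distance
    \<open>2 * R\<close>, together with \<open>v u \<ge> v a / B\<close>.\<close>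
  define b where "b = exp (- (p * \<alpha> / 2) * (2 * R)\<^sup>2) / B"
  have b: "0 < b" using B by (simp add: b_def)
  \<comment> \<open>\<open>8\<close> comes from the selection of discs, \<open>B / b\<close> from
    replacing \<open>h\<close> by \<open>|g|^p\<close> on the disc and its double.\<close>
  have K: "0 < 8 * B / b" using B b by simp
  obtain c where c: "0 < c" and LS: "\<And>g a E. \<lbrakk>g holomorphic_on UNIV; E \<in> sets lebesgue; E \<subseteq> ball a R;
      ennreal \<eta> \<le> emeasure lebesgue E;
      (\<integral>\<^sup>+u\<in>ball a (2 * R). ennreal (cmod (g u) powr p) \<partial>lebesgue)
          \<le> ennreal (8 * B / b) * (\<integral>\<^sup>+u\<in>ball a R. ennreal (cmod (g u) powr p) \<partial>lebesgue)\<rbrakk>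
    \<Longrightarrow> (\<integral>\<^sup>+u\<in>ball a R. ennreal (cmod (g u) powr p) \<partial>lebesgue)
          \<le> ennreal c * (\<integral>\<^sup>+u\<in>E. ennreal (cmod (g u) powr p) \<partial>lebesgue)"
    using local_logvinenko_sereda[OF p R \<eta> K] by blast
  have c': "0 < B * c / b" using B b c by simp
  have "fock_mass p \<alpha> v UNIV f \<le> ennreal (2 * (B * c / b)) * fock_mass p \<alpha> v G f"
    if "f \<in> fock_space p \<alpha> v" for f
  proof -
    have f: "f holomorphic_on UNIV" and fin: "fock_mass p \<alpha> v UNIV f < \<infinity>"
      using that by (auto simp: fock_space_def)
    have holo_meas: "g \<in> borel_measurable lebesgue" if "g holomorphic_on UNIV" for g :: "complex \<Rightarrow> complex"
      using holomorphic_on_imp_continuous_on[OF that] borel_measurable_continuous_onI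
      by (intro measurable_completion) auto
    have [measurable]: "(\<lambda>z::complex. z) \<in> borel_measurable lebesgue" by (rule holo_meas) simp
    have [measurable]: "f \<in> borel_measurable lebesgue" by (rule holo_meas[OF f])
    define h where "h = (\<lambda>z. cmod (f z) powr p * exp (- (p * \<alpha> / 2) * (cmod z)\<^sup>2) * v z)"
    have h[measurable]: "h \<in> borel_measurable lebesgue" unfolding h_def by measurable
    have mass: "fock_mass p \<alpha> v A f = (\<integral>\<^sup>+z\<in>A. ennreal (h z) \<partial>lebesgue)" for A
      by (simp add: fock_mass_def h_def)
    have "(\<integral>\<^sup>+z. ennreal (h z) \<partial>lebesgue) \<le> ennreal (2 * (B * c / b)) * (\<integral>\<^sup>+z\<in>G. ennreal (h z) \<partial>lebesgue)"
    proof (rule good_disc_averaging[OF _ _ G R c'])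
      fix a
      assume good: "(\<integral>\<^sup>+z\<in>ball a (2 * R). ennreal (h z) \<partial>lebesgue) \<le> 8 * (\<integral>\<^sup>+z\<in>ball a R. ennreal (h z) \<partial>lebesgue)"
      define g where "g = (\<lambda>u. f u * exp (- (of_real \<alpha> * cnj a * (u - a))))"
      have g: "g holomorphic_on UNIV" unfolding g_def by (intro holomorphic_intros f)
      have [measurable]: "g \<in> borel_measurable lebesgue" by (rule holo_meas[OF g])
      have gp: "(\<lambda>u. cmod (g u) powr p) \<in> borel_measurable lebesgue" by measurable
      define k where "k = exp (- (p * \<alpha> / 2) * (cmod a)\<^sup>2) * v a"
      have k: "0 < k" using v_pos by (simp add: k_def)
      have h_eq: "h u = cmod (g u) powr p * exp (- (p * \<alpha> / 2) * (cmod a)\<^sup>2)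
          * exp (- (p * \<alpha> / 2) * (cmod (u - a))\<^sup>2) * v u" for u
        unfolding h_def g_def norm_mult powr_mult
          gaussian_translation[symmetric, of p \<alpha> u a]
        by (simp only: mult_ac)
      have h_up: "h u \<le> (B * k) * cmod (g u) powr p" if u: "u \<in> ball a (2 * R)" for u
      proof -
        have "exp (- (p * \<alpha> / 2) * (cmod (u - a))\<^sup>2) * v u \<le> 1 * (B * v a)"
          using up[OF u] p \<alpha> v_pos[of u] by (intro mult_mono) (auto simp: less_imp_le)
        then have "(cmod (g u) powr p * exp (- (p * \<alpha> / 2) * (cmod a)\<^sup>2))
            * (exp (- (p * \<alpha> / 2) * (cmod (u - a))\<^sup>2) * v u)
          \<le> (cmod (g u) powr p * exp (- (p * \<alpha> / 2) * (cmod a)\<^sup>2)) * (1 * (B * v a))"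
          by (intro mult_left_mono) auto
        then show ?thesis unfolding h_eq k_def by (simp only: mult_ac mult_1)
      qed
      have h_dn: "cmod (g u) powr p \<le> (1 / (b * k)) * h u" if u: "u \<in> ball a (2 * R)" for u
      proof -
        have "(cmod (u - a))\<^sup>2 \<le> (2 * R)\<^sup>2"
          using u by (intro power_mono) (auto simp: dist_norm norm_minus_commute)
        then have "p * \<alpha> / 2 * (cmod (u - a))\<^sup>2 \<le> p * \<alpha> / 2 * (2 * R)\<^sup>2"
          using p \<alpha> by (intro mult_left_mono) auto
        then have "exp (- (p * \<alpha> / 2) * (2 * R)\<^sup>2) \<le> exp (- (p * \<alpha> / 2) * (cmod (u - a))\<^sup>2)" by simp
        moreover have "v a / B \<le> v u" using dn[OF u] B by (simp add: field_simps)
        ultimately have "exp (- (p * \<alpha> / 2) * (2 * R)\<^sup>2) * (v a / B)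
            \<le> exp (- (p * \<alpha> / 2) * (cmod (u - a))\<^sup>2) * v u"
          using v_pos[of a] B by (intro mult_mono) (auto simp: less_imp_le)
        then have "(cmod (g u) powr p * exp (- (p * \<alpha> / 2) * (cmod a)\<^sup>2))
            * (exp (- (p * \<alpha> / 2) * (2 * R)\<^sup>2) * (v a / B)) \<le> h u"
          unfolding h_eq mult.assoc[of _ _ "v u"] by (intro mult_left_mono) auto
        then have "cmod (g u) powr p * (b * k) \<le> h u"
          by (simp add: b_def k_def mult_ac)
        then show ?thesis using b k by (simp add: field_simps)
      qed
      let ?J = "\<lambda>A. \<integral>\<^sup>+u\<in>A. ennreal (cmod (g u) powr p) \<partial>lebesgue"
      let ?I = "\<lambda>A. \<integral>\<^sup>+u\<in>A. ennreal (h u) \<partial>lebesgue"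
      have IJ: "?I A \<le> ennreal (B * k) * ?J A" if "A \<in> sets lebesgue" "A \<subseteq> ball a (2 * R)" for A
        using that h_up B k by (intro nn_integral_ratio_bound[OF _ gp]) auto
      have JI: "?J A \<le> ennreal (1 / (b * k)) * ?I A" if "A \<in> sets lebesgue" "A \<subseteq> ball a (2 * R)" for A
        using that h_dn b k by (intro nn_integral_ratio_bound[OF _ h]) auto
      have "?J (ball a (2 * R)) \<le> ennreal (1 / (b * k)) * ?I (ball a (2 * R))"
        by (rule JI) auto
      also have "\<dots> \<le> ennreal (1 / (b * k)) * (ennreal 8 * (ennreal (B * k) * ?J (ball a R)))"
        using good IJ[of "ball a R"] sub[of a]
        by (intro mult_left_mono order_trans[OF good] ) (auto intro: mult_left_mono)
      also have "\<dots> = ennreal (1 / (b * k) * (8 * (B * k))) * ?J (ball a R)"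
        using b k B by (simp only: ennreal_mult' mult.assoc zero_le_divide_iff zero_le_mult_iff less_imp_le zero_le_one zero_le_numeral simp_thms)
      also have "1 / (b * k) * (8 * (B * k)) = 8 * B / b" using k by simp
      finally have "?J (ball a R) \<le> ennreal c * ?J (G \<inter> ball a R)"
        by (intro LS g thick) auto
      then have "ennreal (B * k) * ?J (ball a R) \<le> ennreal (B * k) * (ennreal c * ?J (G \<inter> ball a R))"
        by (rule mult_left_mono) simp
      moreover have "?I (ball a R) \<le> ennreal (B * k) * ?J (ball a R)"
        using sub[of a] by (intro IJ) auto
      ultimately have "?I (ball a R) \<le> ennreal (B * k) * (ennreal c * ?J (G \<inter> ball a R))"
        by (rule order_trans[rotated])
      also have "\<dots> \<le> ennreal (B * k) * (ennreal c * (ennreal (1 / (b * k)) * ?I (G \<inter> ball a R)))"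
        using sub[of a] by (intro mult_left_mono JI) auto
      also have "\<dots> = ennreal (B * k * (c * (1 / (b * k)))) * ?I (G \<inter> ball a R)"
        using b k B c by (simp only: ennreal_mult' mult.assoc zero_le_mult_iff less_imp_le simp_thms)
      also have "B * k * (c * (1 / (b * k))) = B * c / b" using k by simp
      finally show "?I (ball a R) \<le> ennreal (B * c / b) * ?I (G \<inter> ball a R)" .
    qed (use fin in \<open>simp_all add: mass\<close>)
    then show ?thesis by (simp add: mass)
  qed
  then show ?thesis unfolding dominating_def using G c' by (metis mult_pos_pos zero_less_numeral)
qed

subsection \<open>Dominating sets are relatively dense\<close>

text \<open>The \<open>n\<close>-th term majorises, in units of \<open>v a\<close>, the share of the
  annulus \<open>n \<le> |z - a| < n + 1\<close>: growth of the weight, Gaussian at the inner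
  radius, area of the outer disc. The areas grow by at most 4 per step, so
  \<open>C * exp (- b * (2 * n + 1)) \<le> 1/8\<close> gives the ratio \<open>1/2\<close>.\<close>

lemma gaussian_annuli_summable:
  fixes b C :: real
  assumes b: "0 < b" and C: "1 \<le> C"
  shows "summable (\<lambda>n. C ^ (n + 1) * exp (- b * (real n)\<^sup>2) * (pi * (real n + 1)\<^sup>2))"
proof -
  define t where "t = (\<lambda>n. C ^ (n + 1) * exp (- b * (real n)\<^sup>2) * (pi * (real n + 1)\<^sup>2))"
  have "(\<lambda>n. exp (- b * (2 * real n + 1))) \<longlonglongrightarrow> 0" using b by real_asymp
  then have "\<forall>\<^sub>F n in sequentially. exp (- b * (2 * real n + 1)) < 1 / (8 * C)"
    using C by (intro order_tendstoD) auto
  then obtain N where N: "\<And>n. N \<le> n \<Longrightarrow> exp (- b * (2 * real n + 1)) < 1 / (8 * C)"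
    unfolding eventually_sequentially by blast
  have t0: "0 \<le> t n" for n using C by (simp add: t_def)
  have "summable t"
  proof (rule summable_ratio_test[of "1/2" N])
    fix n assume "N \<le> n"
    have e: "exp (- b * (real (Suc n))\<^sup>2) = exp (- b * (real n)\<^sup>2) * exp (- b * (2 * real n + 1))"
      by (simp add: mult_exp_exp power2_eq_square algebra_simps)
    have "(real (Suc n) + 1)\<^sup>2 \<le> 4 * (real n + 1)\<^sup>2"
      by (simp add: power2_eq_square algebra_simps)
    moreover have "C * exp (- b * (2 * real n + 1)) \<le> 1 / 8"
      using N[OF \<open>N \<le> n\<close>] C by (simp add: field_simps)
    ultimately have "(C * exp (- b * (2 * real n + 1))) * (real (Suc n) + 1)\<^sup>2 \<le> 1/8 * (4 * (real n + 1)\<^sup>2)"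
      using C by (intro mult_mono) auto
    then have "(C ^ (n + 1) * exp (- b * (real n)\<^sup>2) * pi) *
        ((C * exp (- b * (2 * real n + 1))) * (real (Suc n) + 1)\<^sup>2)
      \<le> (C ^ (n + 1) * exp (- b * (real n)\<^sup>2) * pi) * (1/8 * (4 * (real n + 1)\<^sup>2))"
      using C by (intro mult_left_mono) auto
    then have "t (Suc n) \<le> 1/2 * t n"
      unfolding t_def e by (simp add: mult_ac)
    then show "norm (t (Suc n)) \<le> 1/2 * norm (t n)" using t0 by simp
  qed simp
  then show ?thesis by (simp add: t_def)
qed

text \<open>Each annulus outside the disc is enlarged to a full disc, which costs nothing against
  the Gaussian. Apart from the factor \<open>v a\<close>, the bound does not depend on
  \<open>a\<close>.\<close>

lemma gaussian_tail_bound: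
  fixes b C :: real and v :: "complex \<Rightarrow> real"
  assumes b: "0 < b" and C: "1 \<le> C" and v_pos: "\<And>z. 0 < v z"
    and v_comp: "\<And>z u n. dist z u \<le> real n \<Longrightarrow> v z \<le> C ^ n * v u"
  shows "(\<integral>\<^sup>+z\<in>- ball a (real m). ennreal (exp (- b * (cmod (z - a))\<^sup>2) * v z) \<partial>lebesgue)
    \<le> ennreal (v a * (\<Sum>n. C ^ (n + m + 1) * exp (- b * (real (n + m))\<^sup>2) * (pi * (real (n + m) + 1)\<^sup>2)))"
proof -
  define q where "q = (\<lambda>n. C ^ (n + 1) * exp (- b * (real n)\<^sup>2))"
  define t where "t = (\<lambda>n. q n * (pi * (real n + 1)\<^sup>2))"
  have q0: "0 \<le> q n" for n using C by (simp add: q_def)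
  have t0: "0 \<le> t n" for n using q0 by (simp add: t_def)
  have va: "0 < v a" by (rule v_pos)
  have le_suminf: "g n \<le> suminf g" for g :: "nat \<Rightarrow> ennreal" and n
    using sum_le_suminf[of g "{n}"] by simp
  have [measurable]: "ball a \<rho> \<in> sets lebesgue" for \<rho> by simp
  have "summable t"
    using gaussian_annuli_summable[OF b C] by (simp add: t_def q_def)
  then have sum: "summable (\<lambda>n. t (n + m))" by (rule summable_ignore_initial_segment)
  have "(\<integral>\<^sup>+z\<in>- ball a (real m). ennreal (exp (- b * (cmod (z - a))\<^sup>2) * v z) \<partial>lebesgue)
      \<le> (\<integral>\<^sup>+z. (\<Sum>n. ennreal (v a * q (n + m)) * indicator (ball a (real (n + m) + 1)) z) \<partial>lebesgue)"
  proof (rule nn_integral_mono)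
    fix z
    let ?f = "\<lambda>n. ennreal (v a * q (n + m)) * indicator (ball a (real (n + m) + 1)) z"
    show "ennreal (exp (- b * (cmod (z - a))\<^sup>2) * v z) * indicator (- ball a (real m)) z \<le> (\<Sum>n. ?f n)"
    proof (cases "z \<in> ball a (real m)")
      case False
      \<comment> \<open>The index of the annulus containing \<open>z\<close>:
        \<open>dist a z \<ge> m\<close> gives \<open>k \<ge> m\<close>, and \<open>v_comp\<close>
        asks for an integer bound on the distance, hence the power \<open>k + 1\<close>.\<close>
      define k where "k = nat \<lfloor>dist a z\<rfloor>"
      have k: "real k \<le> dist a z" "dist a z < real k + 1"
        by (auto simp: k_def)
      have "m \<le> k" using False k(2) by simp
      then obtain n where n: "k = n + m" by (metis add.commute le_Suc_ex)
      have "(real k)\<^sup>2 \<le> (cmod (z - a))\<^sup>2"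
        using k(1) by (intro power_mono) (auto simp: dist_norm norm_minus_commute)
      then have "exp (- b * (cmod (z - a))\<^sup>2) \<le> exp (- b * (real k)\<^sup>2)" using b by simp
      moreover have "v z \<le> C ^ (k + 1) * v a"
        using k(2) by (intro v_comp) (simp add: dist_commute)
      ultimately have "exp (- b * (cmod (z - a))\<^sup>2) * v z \<le> exp (- b * (real k)\<^sup>2) * (C ^ (k + 1) * v a)"
        using v_pos[of z] by (intro mult_mono) (auto simp: less_imp_le)
      also have "\<dots> = v a * q (n + m)" by (simp add: q_def n mult_ac)
      finally have "ennreal (exp (- b * (cmod (z - a))\<^sup>2) * v z) \<le> ennreal (v a * q (n + m))"
        by (rule ennreal_leI)
      also have "\<dots> = ?f n" using k(2) n by simp
      also have "\<dots> \<le> suminf ?f" by (rule le_suminf)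
      finally show ?thesis using False by simp
    qed simp
  qed
  also have "\<dots> = (\<Sum>n. \<integral>\<^sup>+z. ennreal (v a * q (n + m)) * indicator (ball a (real (n + m) + 1)) z \<partial>lebesgue)"
    by (rule nn_integral_suminf) measurable
  also have "\<dots> = (\<Sum>n. ennreal (v a * t (n + m)))"
  proof (rule suminf_cong)
    fix n
    have "0 \<le> real (n + m) + 1" by simp
    note area = emeasure_lebesgue_ball_complex[OF this, of a]
    have "(\<integral>\<^sup>+z. ennreal (v a * q (n + m)) * indicator (ball a (real (n + m) + 1)) z \<partial>lebesgue)
        = ennreal (v a * q (n + m)) * ennreal (pi * (real (n + m) + 1)\<^sup>2)"
      unfolding area[symmetric] by (rule nn_integral_cmult_indicator) simp
    also have "\<dots> = ennreal (v a * q (n + m) * (pi * (real (n + m) + 1)\<^sup>2))"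
      by (rule ennreal_mult'[symmetric]) (use va q0 in simp)
    finally show "(\<integral>\<^sup>+z. ennreal (v a * q (n + m)) * indicator (ball a (real (n + m) + 1)) z \<partial>lebesgue)
        = ennreal (v a * t (n + m))" by (simp only: t_def mult.assoc)
  qed
  also have "\<dots> = ennreal (\<Sum>n. v a * t (n + m))"
    using va t0 sum by (intro suminf_ennreal2 summable_mult) auto
  also have "(\<Sum>n. v a * t (n + m)) = v a * (\<Sum>n. t (n + m))"
    by (rule suminf_mult[OF sum])
  finally show ?thesis by (simp only: t_def q_def)
qed

text \<open>Tested on the normalised kernel at \<^term>\<open>a\<close>, whose mass density is
  \<open>\<lambda>z. exp (- (p * \<alpha> / 2) * (cmod (z - a))\<^sup>2) * v z\<close>.\<close>

lemma dominating_imp_relatively_dense: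
  fixes v :: "complex \<Rightarrow> real"
  assumes p: "0 < p" and \<alpha>: "0 < \<alpha>" and v[measurable]: "v \<in> borel_measurable lebesgue"
    and v_pos: "\<And>z. 0 < v z" and C: "1 \<le> C"
    and v_comp: "\<And>z u n. dist z u \<le> real n \<Longrightarrow> v z \<le> C ^ n * v u"
    and dom: "dominating p \<alpha> v G"
  shows "\<exists>R \<delta>. 0 < R \<and> 0 < \<delta> \<and> \<delta> < 1 \<and>
    (\<forall>a. ennreal \<delta> * wmass v (ball a R) < wmass v (G \<inter> ball a R))"
proof -
  obtain D where D: "0 < D" and G[measurable]: "G \<in> sets lebesgue"
    and dom': "\<And>f. f \<in> fock_space p \<alpha> v \<Longrightarrow> fock_mass p \<alpha> v UNIV f \<le> ennreal D * fock_mass p \<alpha> v G f"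
    using dom unfolding dominating_def by blast
  define b where "b = p * \<alpha> / 2"
  have b: "0 < b" using p \<alpha> by (simp add: b_def)
  define t where "t = (\<lambda>n. C ^ (n + 1) * exp (- b * (real n)\<^sup>2) * (pi * (real n + 1)\<^sup>2))"
  have t: "summable t" unfolding t_def by (rule gaussian_annuli_summable[OF b C])
  have t0: "0 \<le> t n" for n using C by (simp add: t_def)
  \<comment> \<open>These tails do not depend on \<open>a\<close>, so one radius will serve all
    centres.\<close>
  define \<tau> where "\<tau> = (\<lambda>m. \<Sum>n. t (n + m))"
  have \<tau>0: "0 \<le> \<tau> m" for m
    unfolding \<tau>_def using t t0 by (intro suminf_nonneg summable_ignore_initial_segment)
  define h where "h = (\<lambda>a z. exp (- b * (cmod (z - a))\<^sup>2) * v z)"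
  have h0: "0 < h a z" for a z using v_pos by (simp add: h_def)
  have idm[measurable]: "(\<lambda>z::complex. z) \<in> borel_measurable lebesgue"
    by (intro measurable_completion) simp
  have h[measurable]: "h a \<in> borel_measurable lebesgue" for a
    unfolding h_def by measurable
  have tail: "(\<integral>\<^sup>+z\<in>- ball a (real m). ennreal (h a z) \<partial>lebesgue) \<le> ennreal (v a * \<tau> m)" for a m
    using gaussian_tail_bound[where v = v, OF b C v_pos v_comp, of a m] by (simp only: h_def \<tau>_def t_def)
  define f where "f = (\<lambda>a z. exp (of_real \<alpha> * cnj a * z - of_real (\<alpha> * (cmod a)\<^sup>2 / 2)))"
  have mass: "fock_mass p \<alpha> v A (f a) = (\<integral>\<^sup>+z\<in>A. ennreal (h a z) \<partial>lebesgue)" for A a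
  proof -
    have "cmod (f a z) powr p * exp (- (p * \<alpha> / 2) * (cmod z)\<^sup>2) = exp (- b * (cmod (z - a))\<^sup>2)" for z
    proof -
      have sq: "(cmod (z - a))\<^sup>2 = (cmod z)\<^sup>2 - 2 * Re (cnj a * z) + (cmod a)\<^sup>2"
        by (simp add: cmod_power2) (simp add: power2_eq_square algebra_simps)
      have re: "Re (of_real \<alpha> * cnj a * z - of_real (\<alpha> * (cmod a)\<^sup>2 / 2))
          = \<alpha> * Re (cnj a * z) - \<alpha> * (cmod a)\<^sup>2 / 2"
        by (simp add: algebra_simps)
      have "cmod (f a z) powr p = exp (p * Re (of_real \<alpha> * cnj a * z - of_real (\<alpha> * (cmod a)\<^sup>2 / 2)))"
        by (simp add: f_def norm_exp_eq_Re powr_def del: minus_complex.simps)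
      then show ?thesis unfolding re sq b_def by (simp only:) (simp add: mult_exp_exp field_simps)
    qed
    then show ?thesis by (simp add: fock_mass_def h_def)
  qed
  have f_fock: "f a \<in> fock_space p \<alpha> v" for a
  proof -
    have "f a holomorphic_on UNIV" unfolding f_def by (intro holomorphic_intros)
    moreover have "fock_mass p \<alpha> v UNIV (f a) \<le> ennreal (v a * \<tau> 0)"
      using tail[of a 0] by (simp add: mass)
    then have "fock_mass p \<alpha> v UNIV (f a) < \<infinity>" by (simp add: le_less_trans)
    ultimately show ?thesis by (simp add: fock_space_def)
  qed
  \<comment> \<open>From the unit disc alone: area \<open>pi\<close>, Gaussian at least
    \<open>exp (- b)\<close>, weight at least \<open>v a / C\<close>.\<close>
  define \<kappa> where "\<kappa> = pi * exp (- b) / C"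
  have \<kappa>: "0 < \<kappa>" using C by (simp add: \<kappa>_def)
  have lower: "ennreal (v a * \<kappa>) \<le> fock_mass p \<alpha> v UNIV (f a)" for a
  proof -
    have c0: "0 \<le> exp (- b) * (v a / C)" using v_pos[of a] C by simp
    have "ennreal (v a * \<kappa>) = ennreal (exp (- b) * (v a / C)) * emeasure lebesgue (ball a 1)"
      unfolding emeasure_lebesgue_ball_complex[OF zero_le_one] ennreal_mult'[OF c0, symmetric]
      by (simp add: \<kappa>_def mult_ac)
    also have "\<dots> = (\<integral>\<^sup>+z. ennreal (exp (- b) * (v a / C)) * indicator (ball a 1) z \<partial>lebesgue)"
      by (rule nn_integral_cmult_indicator[symmetric]) simp
    also have "\<dots> \<le> (\<integral>\<^sup>+z\<in>UNIV. ennreal (h a z) \<partial>lebesgue)"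
    proof (rule nn_integral_mono)
      fix z
      show "ennreal (exp (- b) * (v a / C)) * indicator (ball a 1) z \<le> ennreal (h a z) * indicator UNIV z"
      proof (cases "z \<in> ball a 1")
        case True
        then have "(cmod (z - a))\<^sup>2 \<le> 1\<^sup>2"
          by (intro power_mono) (auto simp: dist_norm norm_minus_commute)
        then have "exp (- b) \<le> exp (- b * (cmod (z - a))\<^sup>2)" using b by simp
        moreover have "v a / C \<le> v z"
          using v_comp[of a z 1] True C by (simp add: field_simps)
        ultimately have "exp (- b) * (v a / C) \<le> h a z"
          unfolding h_def using v_pos[of a] C by (intro mult_mono) auto
        then show ?thesis using True by (simp add: ennreal_leI)
      qed simp
    qed
    finally show ?thesis by (simp add: mass)
  qed
  \<comment> \<open>With this bound the tail uses up at most half of the mass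
    \<open>v a * \<kappa> / D\<close> that domination guarantees on \<open>G\<close>.\<close>
  have "0 < \<kappa> / (2 * D)" using \<kappa> D by simp
  from suminf_exist_split[OF this t] obtain m0 where m0: "\<And>m. m0 \<le> m \<Longrightarrow> \<tau> m < \<kappa> / (2 * D)"
    unfolding \<tau>_def by fastforce
  \<comment> \<open>The maximum with 1 keeps the radius positive.\<close>
  define m where "m = max 1 m0"
  have m: "1 \<le> m" "\<tau> m < \<kappa> / (2 * D)" using m0[of m] by (auto simp: m_def)
  \<comment> \<open>\<open>G\<close> keeps mass at least \<open>v a * \<kappa> / (2 * D)\<close> in
    the disc, whose total mass is at most \<open>C ^ m * v a * (pi * (real m)\<^sup>2)\<close>. The
    \<open>4\<close> instead of \<open>2\<close> yields strict inequality, and \<open>1/2\<close>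
    secures \<open>\<delta> < 1\<close>.\<close>
  define \<delta> where "\<delta> = min (1/2) (\<kappa> / (4 * D * (C ^ m * (pi * (real m)\<^sup>2))))"
  have den: "0 < 4 * D * (C ^ m * (pi * (real m)\<^sup>2))" using D C m(1) by simp
  have \<delta>: "0 < \<delta>" "\<delta> < 1" using \<kappa> den by (auto simp: \<delta>_def)
  have "ennreal \<delta> * wmass v (ball a (real m)) < wmass v (G \<inter> ball a (real m))" for a
  proof -
    let ?W = "wmass v (G \<inter> ball a (real m))"
    have va: "0 < v a" by (rule v_pos)
    have [measurable]: "ball a (real m) \<in> sets lebesgue" by simp
    have up: "wmass v (ball a (real m)) \<le> ennreal (C ^ m * v a * (pi * (real m)\<^sup>2))"
    proof -
      have "wmass v (ball a (real m)) \<le> (\<integral>\<^sup>+z. ennreal (C ^ m * v a) * indicator (ball a (real m)) z \<partial>lebesgue)"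
        unfolding wmass_def
      proof (rule nn_integral_mono)
        fix z
        show "ennreal (v z) * indicator (ball a (real m)) z
            \<le> ennreal (C ^ m * v a) * indicator (ball a (real m)) z"
          using v_comp[of z a m] by (auto simp: indicator_def dist_commute intro!: ennreal_leI)
      qed
      also have "\<dots> = ennreal (C ^ m * v a) * emeasure lebesgue (ball a (real m))"
        by (rule nn_integral_cmult_indicator) simp
      also have "\<dots> = ennreal (C ^ m * v a * (pi * (real m)\<^sup>2))"
        unfolding emeasure_lebesgue_ball_complex[OF of_nat_0_le_iff]
        by (rule ennreal_mult'[symmetric]) (use C va in simp)
      finally show ?thesis .
    qed
    have "ennreal (v a * \<kappa>) \<le> ennreal D * fock_mass p \<alpha> v G (f a)"
      using lower[of a] dom'[OF f_fock] by (rule order_trans)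
    \<comment> \<open>Inside the disc the Gaussian factor is at most 1, so \<open>v\<close> itself
      appears; outside, the whole tail is given away, whether in \<open>G\<close> or not.\<close>
    also have "fock_mass p \<alpha> v G (f a) \<le> ?W + ennreal (v a * \<tau> m)"
    proof -
      have "fock_mass p \<alpha> v G (f a) \<le> (\<integral>\<^sup>+z. ennreal (v z) * indicator (G \<inter> ball a (real m)) z
          + ennreal (h a z) * indicator (- ball a (real m)) z \<partial>lebesgue)"
        unfolding mass
      proof (rule nn_integral_mono)
        fix z
        have "h a z \<le> 1 * v z"
          unfolding h_def using b v_pos[of z] by (intro mult_right_mono) (auto simp: less_imp_le)
        then show "ennreal (h a z) * indicator G z
          \<le> ennreal (v z) * indicator (G \<inter> ball a (real m)) z + ennreal (h a z) * indicator (- ball a (real m)) z"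
          by (auto simp: indicator_def intro!: ennreal_leI)
      qed
      also have "\<dots> = ?W + (\<integral>\<^sup>+z\<in>- ball a (real m). ennreal (h a z) \<partial>lebesgue)"
        unfolding wmass_def by (rule nn_integral_add) measurable
      also have "\<dots> \<le> ?W + ennreal (v a * \<tau> m)" by (intro add_left_mono tail)
      finally show ?thesis .
    qed
    finally have main: "ennreal (v a * \<kappa>) \<le> ennreal D * (?W + ennreal (v a * \<tau> m))"
      by (simp add: mult_left_mono)
    have fin: "?W < \<infinity>"
      unfolding infinity_ennreal_def
      by (rule le_less_trans[OF order_trans[OF wmass_mono[OF Int_lower2] up] ennreal_less_top])
    define W where "W = enn2real ?W"
    have W: "?W = ennreal W" "0 \<le> W" using fin by (auto simp: W_def)
    have vt: "0 \<le> v a * \<tau> m" using va \<tau>0[of m] by simp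
    have "ennreal D * (?W + ennreal (v a * \<tau> m)) = ennreal (D * (W + v a * \<tau> m))"
      unfolding W(1) ennreal_plus[OF W(2) vt, symmetric] using D by (simp add: ennreal_mult')
    then have "v a * \<kappa> \<le> D * (W + v a * \<tau> m)"
      using main D W(2) vt by (simp only: ennreal_le_iff[OF mult_nonneg_nonneg[OF less_imp_le[OF D] add_nonneg_nonneg[OF W(2) vt]]])
    moreover have "D * (v a * \<tau> m) \<le> v a * (\<kappa> / 2)"
    proof -
      have "D * \<tau> m \<le> \<kappa> / 2" using m(2) D by (simp add: field_simps)
      then have "v a * (D * \<tau> m) \<le> v a * (\<kappa> / 2)" using va by (intro mult_left_mono) auto
      then show ?thesis by (simp only: mult_ac)
    qed
    ultimately have W_low: "v a * \<kappa> / 2 \<le> D * W" by (simp add: algebra_simps)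
    have "\<delta> * (C ^ m * v a * (pi * (real m)\<^sup>2)) \<le> \<kappa> / (4 * D * (C ^ m * (pi * (real m)\<^sup>2))) * (C ^ m * v a * (pi * (real m)\<^sup>2))"
      using C va by (intro mult_right_mono) (auto simp: \<delta>_def)
    also have "\<dots> = v a * \<kappa> / (4 * D)"
      using D C m(1) by simp
    also have "\<dots> < v a * \<kappa> / (2 * D)" using va \<kappa> D by (simp add: field_simps)
    also have "\<dots> \<le> W" using W_low D by (simp add: field_simps)
    finally have "\<delta> * (C ^ m * v a * (pi * (real m)\<^sup>2)) < W" .
    then have "ennreal (\<delta> * (C ^ m * v a * (pi * (real m)\<^sup>2))) < ennreal W"
      using \<delta> C va by (intro ennreal_lessI) (auto intro: le_less_trans[rotated])
    moreover have "ennreal \<delta> * wmass v (ball a (real m)) \<le> ennreal (\<delta> * (C ^ m * v a * (pi * (real m)\<^sup>2)))"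
      unfolding ennreal_mult'[OF less_imp_le[OF \<delta>(1)]] by (intro mult_left_mono up) simp
    ultimately show ?thesis unfolding W(1) by (rule le_less_trans[rotated])
  qed
  then show ?thesis using \<delta> m(1) by (intro exI[of _ "real m"] exI[of _ \<delta>]) auto
qed

theorem theorem3p3:
  fixes p \<alpha> :: real and w :: "complex \<Rightarrow> real" and G :: "complex set"
  assumes "0 < p" and "0 < \<alpha>"
    and "w \<in> Ainf_restricted"
    and "G \<in> sets lebesgue"
  shows "dominating p \<alpha> (what w) G \<longleftrightarrow>
    (\<exists>R \<delta> :: real. R > 0 \<and> 0 < \<delta> \<and> \<delta> < 1 \<and>
      (\<forall>a::complex. wmass (what w) (G \<inter> ball a R) > ennreal \<delta> * wmass (what w) (ball a R)))"
proof -
  have meas: "what w \<in> borel_measurable lebesgue"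
    by (rule what_measurable[OF Ainf_restricted_weight[OF assms(3)]])
  obtain C where C: "1 \<le> C" and pos: "\<And>z. 0 < what w z"
    and comp: "\<And>z u n. dist z u \<le> real n \<Longrightarrow> what w z \<le> C ^ n * what w u"
    using what_comparable[OF assms(3)] by blast
  show ?thesis
  proof
    assume "dominating p \<alpha> (what w) G"
    then show "\<exists>R \<delta> :: real. R > 0 \<and> 0 < \<delta> \<and> \<delta> < 1 \<and>
        (\<forall>a::complex. wmass (what w) (G \<inter> ball a R) > ennreal \<delta> * wmass (what w) (ball a R))"
      using dominating_imp_relatively_dense[OF assms(1,2) meas pos C, of G] comp by blast
  next
    assume "\<exists>R \<delta> :: real. R > 0 \<and> 0 < \<delta> \<and> \<delta> < 1 \<and>
        (\<forall>a::complex. wmass (what w) (G \<inter> ball a R) > ennreal \<delta> * wmass (what w) (ball a R))"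
    then obtain R \<delta> where "0 < R" "0 < \<delta>"
      and "\<And>a. ennreal \<delta> * wmass (what w) (ball a R) < wmass (what w) (G \<inter> ball a R)" by blast
    then show "dominating p \<alpha> (what w) G"
      using comp
      by (intro relatively_dense_imp_dominating[where R = R and \<delta> = \<delta>, OF assms(1,2) meas pos C _ assms(4)])
        (auto intro: less_imp_le)
  qed
qed

end
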